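(* Let $K\in\{0,\ldots,N\}$, and let the norms $\|\cdot\|$ and $f_d$ on $\mathbb{R}^N$ and the dictionary $(\psi_i)_{i\in I}$ be arbitrary. Let $\tau>0$ and $\theta\ge\tau\Delta_K$. Then $$\overline{C}_K\,\tau^{N-K}(\theta-\hat\delta_K\tau)^K-\theta^N\varepsilon_0(K,\tau,\theta)\ \le\ \mathbb{L}^N\left(\mathcal{I}^K(\tau)\cap\mathcal{L}_{f_d}(\theta)\right)\ \le\ \overline{C}_K\,\tau^{N-K}(\theta+\hat\delta_K\tau)^K,$$ where $\varepsilon_0(K,\tau,\theta)=0$ if $K=0$ or $K=N$, and $$\varepsilon_0(K,\tau,\theta)=\sum_{k=k_K}^{K-1}\overline{Q}_{K,k}\left(\frac{\tau}{\theta}\right)^{N-k}\left(1+\hat\delta'_{K,k}\frac{\tau}{\theta}\right)^k\quad\text{if }0<K<N.$$ Moreover, $0\le\hat\delta_K\le\overline{\Delta}$, $0\le\Delta_K\le 3\overline{\Delta}$, and, for $0<K<N$ and $k_K\le k\le K-1$, $0\le\hat\delta'_{K,k}\le 3\overline{\Delta}$.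
   Context: $N\ge1$ is an integer; $\|\cdot\|$ and $f_d$ are arbitrary norms on $\mathbb{R}^N$; $\|\cdot\|_2$ is the Euclidean norm; the dictionary $(\psi_i)_{i\in I}$ is a finite family in $\mathbb{R}^N$ with $\mathrm{span}\{\psi_i:i\in I\}=\mathbb{R}^N$. For $d\in\mathbb{R}^N$ and $\tau>0$, $\mathrm{val}(\mathcal{P}_d)$ is the minimum of $\#\{i\in I:\lambda_i\neq0\}$ over all $(\lambda_i)_{i\in I}\in\mathbb{R}^I$ with $\|\sum_{i\in I}\lambda_i\psi_i-d\|\le\tau$. Set $\mathcal{I}^K(\tau)=\{d\in\mathbb{R}^N:\mathrm{val}(\mathcal{P}_d)\le K\}$. For a function $f$, $\mathcal{L}_f(t)=\{w:f(w)\le t\}$. $P_V$ is the orthogonal projection onto a subspace $V$, $V^\bot$ the orthogonal complement. $\mathbb{L}^k$ is $k$-dimensional Lebesgue measure (on a $k$-dimensional subspace of $\mathbb{R}^N$, via identification with $\mathbb{R}^k$ by an orthonormal basis), with $\mathbb{L}^0(\{0\})=1$; zeroth powers equal $1$. For $J\subset I$: $\mathcal{T}_J=\mathrm{span}((\psi_j)_{j\in J})$ ($\mathrm{span}(\emptyset)=\{0\}$) and $\mathcal{T}_J^\tau=\mathcal{T}_J+P_{\mathcal{T}_J^\bot}(\mathcal{L}_{\|\cdot\|}(\tau))$. Constants. Fix $\delta_1,\delta_2>0$ with $f_d(w)\le\delta_1\|w\|_2$ and $\|w\|_2\le\delta_2\|w\|$ for all $w\in\mathbb{R}^N$, and let $\overline{\Delta}=\delta_1\delta_2$.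 For $J\subset I$, let $h_J$ be the norm on $\mathcal{T}_J^\bot$ given by $h_J(u)=\inf\{t>0:u/t\in P_{\mathcal{T}_J^\bot}(\mathcal{L}_{\|\cdot\|}(1))\}$; $\delta_J\in[0,\overline{\Delta}]$ is a fixed constant with $f_d(u)\le\delta_Jh_J(u)$ for all $u\in\mathcal{T}_J^\bot$; and, with $K=\dim\mathcal{T}_J$, $C_J=\mathbb{L}^{N-K}\big(P_{\mathcal{T}_J^\bot}(\mathcal{L}_{\|\cdot\|}(1))\big)\,\mathbb{L}^K\big(\mathcal{T}_J\cap\mathcal{L}_{f_d}(1)\big)$. $\mathcal{J}(K)$ is a fixed collection of subsets $J\subset I$ with $\dim\mathcal{T}_J=K$, such that distinct members have distinct spans $\mathcal{T}_J$ and every $K$-dimensional subspace of the form $\mathcal{T}_{J_1}$, $J_1\subset I$, equals $\mathcal{T}_J$ for some $J\in\mathcal{J}(K)$; $\mathcal{J}(0)=\{\emptyset\}$. Set $\hat\delta_K=\max_{J\in\mathcal{J}(K)}\delta_J$ and $\overline{C}_K=\sum_{J\in\mathcal{J}(K)}C_J$. Let $k_K=\max\{0,2K-N\}$ and $\mathcal{H}(K,k)=\{(J_1,J_2)\in\mathcal{J}(K)^2:\dim(\mathcal{T}_{J_1}\cap\mathcal{T}_{J_2})=k\}$ for $0\le k\le K-1$. For $(J_1,J_2)\in\mathcal{H}(K,k)$ put $W=\mathcal{T}_{J_1}\cap\mathcal{T}_{J_2}$ and $$Q_{J_1,J_2}=\mathbb{L}^{N-k}\big(W^\bot\cap\mathcal{L}_{\|\cdot\|_2}(2\delta_2)\big)\,\mathbb{L}^k\big(W\cap\mathcal{L}_{f_d}(1)\big),$$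 and let $\delta_{J_1,J_2}\in[0,3\overline{\Delta}]$ be a fixed constant such that for all $\tau,\theta>0$ with $\theta\ge\delta_{J_1,J_2}\tau$, $$\mathbb{L}^N\big(\mathcal{T}_{J_1}^\tau\cap\mathcal{T}_{J_2}^\tau\cap\mathcal{L}_{f_d}(\theta)\big)\le Q_{J_1,J_2}\tau^{N-k}(\theta+\delta_{J_1,J_2}\tau)^k.$$ For $1\le K\le N-1$ and $k_K\le k\le K-1$: $\hat\delta'_{K,k}=\max\{0,\max_{(J_1,J_2)\in\mathcal{H}(K,k)}\delta_{J_1,J_2}\}$ and $\overline{Q}_{K,k}=\sum_{(J_1,J_2)\in\mathcal{H}(K,k)}Q_{J_1,J_2}$ (both are $0$ if $\mathcal{H}(K,k)=\emptyset$). Finally $\Delta_0=\hat\delta_0$; $\Delta_K=\max\{\Delta_{K-1},\hat\delta_K,\max_{k_K\le k\le K-1}\hat\delta'_{K,k}\}$ for $0<K<N$; $\Delta_N=\max\{\Delta_{N-1},\hat\delta_N\}$. *)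

theory Defs
  imports "HOL-Analysis.Analysis"
begin

definition is_norm :: "('a::real_vector \<Rightarrow> real) \<Rightarrow> bool" where
  "is_norm f \<longleftrightarrow>
     (\<forall>x. 0 \<le> f x) \<and> (\<forall>x. f x = 0 \<longleftrightarrow> x = 0) \<and>
     (\<forall>c x. f (c *\<^sub>R x) = \<bar>c\<bar> * f x) \<and> (\<forall>x y. f (x + y) \<le> f x + f y)"

definition sublevel :: "('a \<Rightarrow> real) \<Rightarrow> real \<Rightarrow> 'a set" where
  "sublevel f t = {w. f w \<le> t}"

definition orth_proj :: "'a::euclidean_space set \<Rightarrow> 'a \<Rightarrow> 'a" where
  "orth_proj V x = (THE y. y \<in> V \<and> x - y \<in> orthogonal_comp V)"

definition orthonormal_basis_of :: "'a::euclidean_space set \<Rightarrow> 'a set \<Rightarrow> bool" where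
  "orthonormal_basis_of V B \<longleftrightarrow>
     pairwise orthogonal B \<and> (\<forall>b\<in>B. norm b = 1) \<and> span B = V"

text \<open>Lebesgue measure on a linear subspace \<open>V\<close>, as a measure on the ambient space carried
  by \<open>V\<close>: with \<open>B\<close> an orthonormal basis of \<open>V\<close>, the product Lebesgue measure on the
  coordinate space of functions on \<open>B\<close> is transported by the coordinate isometry and completed.
  By rotation invariance the choice of \<open>B\<close> is immaterial. For \<open>V = {0}\<close> we have \<open>B = {}\<close> and
  obtain the unit point mass at \<open>0\<close>.\<close>

definition subspace_lebesgue :: "'a::euclidean_space set \<Rightarrow> 'a measure" where
  "subspace_lebesgue V =
     (let B = (SOME B. orthonormal_basis_of V B)
      in completion (distr (\<Pi>\<^sub>M b\<in>B. (lborel :: real measure)) borel (\<lambda>c. \<Sum>b\<in>B. c b *\<^sub>R b)))"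

text \<open>The sparsity problem. The dictionary is the family \<open>\<psi>\<close> indexed by the finite set \<open>I\<close>.
  The infimum of natural numbers is a minimum as soon as the problem is feasible, which is the
  case when the dictionary spans the space.\<close>

definition spval :: "('a::real_vector \<Rightarrow> real) \<Rightarrow> ('i \<Rightarrow> 'a) \<Rightarrow> 'i set \<Rightarrow> real \<Rightarrow> 'a \<Rightarrow> nat" where
  "spval nrm \<psi> I \<tau> d =
     Inf {card {i\<in>I. c i \<noteq> 0} | c :: 'i \<Rightarrow> real. nrm ((\<Sum>i\<in>I. c i *\<^sub>R \<psi> i) - d) \<le> \<tau>}"

definition sparse_data ::
  "('a::real_vector \<Rightarrow> real) \<Rightarrow> ('i \<Rightarrow> 'a) \<Rightarrow> 'i set \<Rightarrow> nat \<Rightarrow> real \<Rightarrow> 'a set" where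
  "sparse_data nrm \<psi> I K \<tau> = {d. spval nrm \<psi> I \<tau> d \<le> K}"

definition spanT :: "('i \<Rightarrow> 'a::real_vector) \<Rightarrow> 'i set \<Rightarrow> 'a set" where
  "spanT \<psi> J = span (\<psi> ` J)"

definition cylT ::
  "('a::euclidean_space \<Rightarrow> real) \<Rightarrow> ('i \<Rightarrow> 'a) \<Rightarrow> 'i set \<Rightarrow> real \<Rightarrow> 'a set" where
  "cylT nrm \<psi> J \<tau> =
     {x + y | x y. x \<in> spanT \<psi> J \<and>
        y \<in> orth_proj (orthogonal_comp (spanT \<psi> J)) ` sublevel nrm \<tau>}"

definition proj_norm ::
  "('a::euclidean_space \<Rightarrow> real) \<Rightarrow> ('i \<Rightarrow> 'a) \<Rightarrow> 'i set \<Rightarrow> 'a \<Rightarrow> real" where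
  "proj_norm nrm \<psi> J u =
     Inf {t. 0 < t \<and> (1 / t) *\<^sub>R u \<in> orth_proj (orthogonal_comp (spanT \<psi> J)) ` sublevel nrm 1}"

definition const_C ::
  "('a::euclidean_space \<Rightarrow> real) \<Rightarrow> ('a \<Rightarrow> real) \<Rightarrow> ('i \<Rightarrow> 'a) \<Rightarrow> 'i set \<Rightarrow> real" where
  "const_C nrm fd \<psi> J =
     measure (subspace_lebesgue (orthogonal_comp (spanT \<psi> J)))
       (orth_proj (orthogonal_comp (spanT \<psi> J)) ` sublevel nrm 1)
     * measure (subspace_lebesgue (spanT \<psi> J)) (spanT \<psi> J \<inter> sublevel fd 1)"

definition const_Q ::
  "real \<Rightarrow> ('a::euclidean_space \<Rightarrow> real) \<Rightarrow> ('i \<Rightarrow> 'a) \<Rightarrow> 'i set \<Rightarrow> 'i set \<Rightarrow> real" where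
  "const_Q \<delta>2 fd \<psi> J1 J2 =
     (let W = spanT \<psi> J1 \<inter> spanT \<psi> J2
      in measure (subspace_lebesgue (orthogonal_comp W)) (orthogonal_comp W \<inter> sublevel norm (2 * \<delta>2))
         * measure (subspace_lebesgue W) (W \<inter> sublevel fd 1))"

text \<open>A choice, for each \<open>K\<close> up to the dimension, of exactly one index set for every
  \<open>K\<close>-dimensional subspace spanned by part of the dictionary.\<close>

definition span_representatives ::
  "('i \<Rightarrow> 'a::euclidean_space) \<Rightarrow> 'i set \<Rightarrow> (nat \<Rightarrow> 'i set set) \<Rightarrow> bool" where
  "span_representatives \<psi> I \<J> \<longleftrightarrow>
     (\<forall>K\<le>DIM('a).
        (\<forall>J\<in>\<J> K. J \<subseteq> I \<and> dim (spanT \<psi> J) = K) \<and>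
        inj_on (spanT \<psi>) (\<J> K) \<and>
        (\<forall>J1\<subseteq>I. dim (spanT \<psi> J1) = K \<longrightarrow> (\<exists>J\<in>\<J> K. spanT \<psi> J1 = spanT \<psi> J))) \<and>
     \<J> 0 = {{}}"

definition pairs_H ::
  "('i \<Rightarrow> 'a::euclidean_space) \<Rightarrow> (nat \<Rightarrow> 'i set set) \<Rightarrow> nat \<Rightarrow> nat \<Rightarrow> ('i set \<times> 'i set) set" where
  "pairs_H \<psi> \<J> K k =
     {(J1, J2). J1 \<in> \<J> K \<and> J2 \<in> \<J> K \<and> dim (spanT \<psi> J1 \<inter> spanT \<psi> J2) = k}"

definition hat_delta :: "(nat \<Rightarrow> 'i set set) \<Rightarrow> ('i set \<Rightarrow> real) \<Rightarrow> nat \<Rightarrow> real" where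
  "hat_delta \<J> \<delta> K = Max (\<delta> ` \<J> K)"

definition bar_C ::
  "('a::euclidean_space \<Rightarrow> real) \<Rightarrow> ('a \<Rightarrow> real) \<Rightarrow> ('i \<Rightarrow> 'a) \<Rightarrow> (nat \<Rightarrow> 'i set set) \<Rightarrow> nat \<Rightarrow> real"
where
  "bar_C nrm fd \<psi> \<J> K = (\<Sum>J\<in>\<J> K. const_C nrm fd \<psi> J)"

text \<open>\<open>\<delta>'\<close> assigns a constant to every ordered pair of index sets.\<close>

definition hat_delta' ::
  "('i \<Rightarrow> 'a::euclidean_space) \<Rightarrow> (nat \<Rightarrow> 'i set set) \<Rightarrow> ('i set \<Rightarrow> 'i set \<Rightarrow> real) \<Rightarrow> nat \<Rightarrow> nat \<Rightarrow> real"
where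
  "hat_delta' \<psi> \<J> \<delta>' K k = Max (insert 0 ((\<lambda>(J1, J2). \<delta>' J1 J2) ` pairs_H \<psi> \<J> K k))"

definition bar_Q ::
  "real \<Rightarrow> ('a::euclidean_space \<Rightarrow> real) \<Rightarrow> ('i \<Rightarrow> 'a) \<Rightarrow> (nat \<Rightarrow> 'i set set) \<Rightarrow> nat \<Rightarrow> nat \<Rightarrow> real"
where
  "bar_Q \<delta>2 fd \<psi> \<J> K k = (\<Sum>(J1, J2)\<in>pairs_H \<psi> \<J> K k. const_Q \<delta>2 fd \<psi> J1 J2)"

text \<open>Truncated subtraction on \<open>nat\<close> makes this \<open>max {0, 2 K - N}\<close>.\<close>

definition k_min :: "nat \<Rightarrow> nat \<Rightarrow> nat" where
  "k_min N K = 2 * K - N"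

text \<open>Only the values at \<open>K \<le> DIM('a)\<close> are meaningful.\<close>

fun Delta ::
  "('i \<Rightarrow> 'a::euclidean_space) \<Rightarrow> (nat \<Rightarrow> 'i set set) \<Rightarrow> ('i set \<Rightarrow> real)
     \<Rightarrow> ('i set \<Rightarrow> 'i set \<Rightarrow> real) \<Rightarrow> nat \<Rightarrow> real"
where
  "Delta \<psi> \<J> \<delta> \<delta>' 0 = hat_delta \<J> \<delta> 0"
| "Delta \<psi> \<J> \<delta> \<delta>' (Suc K) =
     (if Suc K < DIM('a)
      then Max {Delta \<psi> \<J> \<delta> \<delta>' K, hat_delta \<J> \<delta> (Suc K),
                Max (hat_delta' \<psi> \<J> \<delta>' (Suc K) ` {k_min DIM('a) (Suc K)..K})}
      else max (Delta \<psi> \<J> \<delta> \<delta>' K) (hat_delta \<J> \<delta> (Suc K)))"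

definition eps0 ::
  "real \<Rightarrow> ('a::euclidean_space \<Rightarrow> real) \<Rightarrow> ('i \<Rightarrow> 'a) \<Rightarrow> (nat \<Rightarrow> 'i set set)
     \<Rightarrow> ('i set \<Rightarrow> 'i set \<Rightarrow> real) \<Rightarrow> nat \<Rightarrow> real \<Rightarrow> real \<Rightarrow> real"
where
  "eps0 \<delta>2 fd \<psi> \<J> \<delta>' K \<tau> \<theta> =
     (if 0 < K \<and> K < DIM('a)
      then \<Sum>k = k_min DIM('a) K..K - 1.
             bar_Q \<delta>2 fd \<psi> \<J> K k * (\<tau> / \<theta>) ^ (DIM('a) - k)
             * (1 + hat_delta' \<psi> \<J> \<delta>' K k * (\<tau> / \<theta>)) ^ k
      else 0)"

end

theory Submission
  imports Defs
begin

text \<open>The set \<open>I\<^sup>K(\<tau>)\<close> is the finite union of the cylinders \<open>T\<^sub>J\<^sup>\<tau>\<close> over the representatives \<open>J\<close> of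
  the \<open>K\<close>-dimensional spans. Lebesgue measure factors along an orthogonal splitting \<open>V + V\<^sup>\<bottom>\<close>, so
  each truncated cylinder has measure between \<open>C\<^sub>J \<tau>\<^bsup>N-K\<^esup> (\<theta> - \<delta>\<^sub>J \<tau>)\<^sup>K\<close> and the same expression with \<open>+\<close>.
  Subadditivity gives the upper bound. For the lower bound, Bonferroni's inequality subtracts the
  pairwise intersections; distinct \<open>K\<close>-dimensional spans meet in dimension \<open>k\<close> with
  \<open>2 K - N \<le> k < K\<close>, and grouping the pairs by \<open>k\<close> produces the error term. Division by \<open>\<theta>\<close> there is
  harmless: \<open>\<delta>\<close> at the empty index set is positive, hence so is \<open>\<theta>\<close>.\<close>

section \<open>Lebesgue measure in orthonormal coordinates\<close>

lemma nn_integral_lborel_shift: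
  fixes f :: "'a::euclidean_space \<Rightarrow> ennreal"
  assumes [measurable]: "f \<in> borel_measurable borel"
  shows "(\<integral>\<^sup>+x. f (c + x) \<partial>lborel) = (\<integral>\<^sup>+x. f x \<partial>lborel)"
proof -
  have "(\<integral>\<^sup>+x. f x \<partial>lborel) = (\<integral>\<^sup>+x. f x \<partial>distr lborel borel ((+) c))"
    by (simp add: lborel_distr_plus)
  also have "\<dots> = (\<integral>\<^sup>+x. f (c + x) \<partial>lborel)"
    by (rule nn_integral_distr) auto
  finally show ?thesis ..
qed

text \<open>Two translation-invariant measures are proportional by Fubini; they coincide here because
  \<open>T\<close> preserves the unit ball.\<close>

lemma distr_lborel_orthogonal_transformation:
  fixes T :: "'a::euclidean_space \<Rightarrow> 'a"
  assumes T: "orthogonal_transformation T"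
  shows "distr lborel borel T = lborel"
proof (rule measure_eqI)
  have lin: "linear T"
    using T by (rule orthogonal_transformation_linear)
  then have [measurable]: "T \<in> borel_measurable borel"
    by (intro borel_measurable_continuous_onI linear_continuous_on linear_conv_bounded_linear[THEN iffD1])
  fix A assume "A \<in> sets (distr lborel borel T)"
  then have A[measurable]: "A \<in> sets borel" by simp
  \<comment> \<open>The unit ball is invariant under \<open>T\<close> and under negation and has
    positive finite measure, so it can serve as a test set and be cancelled at the end.\<close>
  define U where "U = ball (0::'a) 1"
  have [measurable]: "U \<in> sets borel"
    by (simp add: U_def)
  have U_symm: "- x \<in> U \<longleftrightarrow> x \<in> U" and U_T: "T x \<in> U \<longleftrightarrow> x \<in> U" for x
    using T by (auto simp: U_def orthogonal_transformation_norm)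
  have "emeasure lborel (T -` A) * emeasure lborel U
      = (\<integral>\<^sup>+x. indicator A (T x) * (\<integral>\<^sup>+y. indicator U y \<partial>lborel) \<partial>lborel)"
  proof -
    have "(\<integral>\<^sup>+x. indicator A (T x) \<partial>lborel) = (\<integral>\<^sup>+x. indicator (T -` A) x \<partial>lborel)"
      by (simp add: indicator_vimage)
    moreover have "T -` A \<in> sets borel"
      using measurable_sets[of T borel borel A] by simp
    ultimately show ?thesis
      by (simp add: nn_integral_multc)
  qed
  \<comment> \<open>Translation invariance allows the shift of \<open>y\<close> by
    \<open>- T x\<close>, which couples the two variables before the order of integration is
    exchanged.\<close>
  also have "\<dots> = (\<integral>\<^sup>+x. indicator A (T x) * (\<integral>\<^sup>+y. indicator U (- T x + y) \<partial>lborel) \<partial>lborel)"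
    by (simp only: nn_integral_lborel_shift[of "indicator U", OF borel_measurable_indicator] \<open>U \<in> sets borel\<close>)
  also have "\<dots> = (\<integral>\<^sup>+x. (\<integral>\<^sup>+y. indicator A (T x) * indicator U (- T x + y) \<partial>lborel) \<partial>lborel)"
    by (simp add: nn_integral_cmult)
  also have "\<dots> = (\<integral>\<^sup>+y. (\<integral>\<^sup>+x. indicator A (T x) * indicator U (- T x + y) \<partial>lborel) \<partial>lborel)"
    by (rule lborel_pair.Fubini'[symmetric]) simp
  also have "\<dots> = (\<integral>\<^sup>+y. (\<integral>\<^sup>+x. indicator A (T x + y) * indicator U x \<partial>lborel) \<partial>lborel)"
  proof (rule nn_integral_cong)
    fix y :: 'a
    \<comment> \<open>Shifting \<open>x\<close> by a preimage \<open>z\<close> of \<open>y\<close>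
      turns \<open>- T x + y\<close> into \<open>- T x\<close>; the symmetries of \<open>U\<close>
      then remove both the sign and \<open>T\<close>.\<close>
    obtain z where z: "T z = y"
      using orthogonal_transformation_surj[OF T] by (metis surjD)
    have "(\<integral>\<^sup>+x. indicator A (T x) * indicator U (- T x + y) \<partial>lborel)
        = (\<integral>\<^sup>+x. indicator A (T (z + x)) * indicator U (- T (z + x) + y) \<partial>lborel :: ennreal)"
      by (rule nn_integral_lborel_shift[symmetric]) auto
    also have "\<dots> = (\<integral>\<^sup>+x. indicator A (T x + y) * indicator U x \<partial>lborel)"
      using U_symm U_T by (intro nn_integral_cong)
        (auto simp: linear_add[OF lin] z indicator_def add.commute)
    finally show "(\<integral>\<^sup>+x. indicator A (T x) * indicator U (- T x + y) \<partial>lborel)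
        = (\<integral>\<^sup>+x. indicator A (T x + y) * indicator U x \<partial>lborel :: ennreal)" .
  qed
  also have "\<dots> = (\<integral>\<^sup>+x. (\<integral>\<^sup>+y. indicator A (T x + y) * indicator U x \<partial>lborel) \<partial>lborel)"
    by (rule lborel_pair.Fubini') simp
  also have "\<dots> = (\<integral>\<^sup>+x. (\<integral>\<^sup>+y. indicator A (T x + y) \<partial>lborel) * indicator U x \<partial>lborel)"
    by (simp add: nn_integral_multc)
  also have "\<dots> = (\<integral>\<^sup>+x. emeasure lborel A * indicator U x \<partial>lborel)"
    by (subst nn_integral_lborel_shift) auto
  also have "\<dots> = emeasure lborel A * emeasure lborel U"
    by (simp add: nn_integral_cmult)
  finally have eq: "emeasure lborel (T -` A) * emeasure lborel U = emeasure lborel A * emeasure lborel U" .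
  have "emeasure lborel U \<noteq> 0"
    using content_ball_pos[of 1 "0::'a"] by (auto simp: U_def measure_def)
  moreover have "emeasure lborel U \<noteq> top"
    using emeasure_lborel_ball_finite[of "0::'a" 1] by (auto simp: U_def)
  ultimately have "emeasure lborel (T -` A) = emeasure lborel A"
    using eq by (metis ennreal_mult_divide_eq)
  then show "emeasure (distr lborel borel T) A = emeasure lborel A"
    by (simp add: emeasure_distr)
qed simp

section \<open>Product Lebesgue measure on coordinate spaces\<close>

interpretation lborel_product: product_sigma_finite "\<lambda>_. lborel :: real measure"
  by standard

text \<open>A product measure is determined by its values on boxes. The preimage of a box is the box
  with relabelled sides, and a bijection does not change the product of the side lengths.\<close>

lemma distr_PiM_lborel_reindex:
  assumes f: "bij_betw f A B" and fin: "finite A"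
  shows "distr (\<Pi>\<^sub>M b\<in>B. lborel :: real measure) (\<Pi>\<^sub>M a\<in>A. lborel) (\<lambda>c. \<lambda>a\<in>A. c (f a)) = (\<Pi>\<^sub>M a\<in>A. lborel)"
proof (rule lborel_product.PiM_eqI)
  have finB: "finite B"
    using f fin bij_betw_finite by blast
  have fA: "f a \<in> B" if "a \<in> A" for a
    using f that by (auto simp: bij_betw_def)
  have [measurable]: "(\<lambda>c. \<lambda>a\<in>A. c (f a)) \<in> (\<Pi>\<^sub>M b\<in>B. lborel :: real measure) \<rightarrow>\<^sub>M (\<Pi>\<^sub>M a\<in>A. lborel)"
    by (intro measurable_restrict measurable_component_singleton fA)
  fix X :: "_ \<Rightarrow> real set" assume X: "\<And>i. i \<in> A \<Longrightarrow> X i \<in> sets lborel"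
  let ?g = "inv_into A f"
  have g: "?g b \<in> A" "f (?g b) = b" if "b \<in> B" for b
    using that f bij_betw_inv_into bij_betwE bij_betw_inv_into_right by fastforce+
  have gf: "?g (f a) = a" if "a \<in> A" for a
    using that f by (simp add: bij_betw_inv_into_left)
  have "((\<lambda>c. \<lambda>a\<in>A. c (f a)) -` Pi\<^sub>E A X) \<inter> space (\<Pi>\<^sub>M b\<in>B. lborel :: real measure) = Pi\<^sub>E B (\<lambda>b. X (?g b))"
    using g gf fA by (auto simp: space_PiM PiE_iff) metis+
  moreover have "emeasure (\<Pi>\<^sub>M b\<in>B. lborel) (Pi\<^sub>E B (\<lambda>b. X (?g b))) = (\<Prod>b\<in>B. emeasure lborel (X (?g b)))"
    using X g by (intro lborel_product.emeasure_PiM finB) auto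
  moreover have "\<dots> = (\<Prod>a\<in>A. emeasure lborel (X a))"
    using prod.reindex_bij_betw[OF f, of "\<lambda>b. emeasure lborel (X (?g b))"] gf by simp
  ultimately show "emeasure (distr (\<Pi>\<^sub>M b\<in>B. lborel) (\<Pi>\<^sub>M a\<in>A. lborel) (\<lambda>c. \<lambda>a\<in>A. c (f a))) (Pi\<^sub>E A X)
      = (\<Prod>a\<in>A. emeasure lborel (X a))"
    using X fin by (subst emeasure_distr) (auto intro!: sets_PiM_I_finite)
qed (use fin in simp_all)

text \<open>Each of the \<open>card B\<close> factors contributes one \<open>t\<close>, as is
  checked on boxes. Written this way round, the identity gives the measure of a dilated set
  directly.\<close>

lemma distr_PiM_lborel_scale:
  assumes fin: "finite B" and t: "(t::real) > 0"
  shows "(\<Pi>\<^sub>M b\<in>B. lborel :: real measure)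
    = scale_measure (t ^ card B) (distr (\<Pi>\<^sub>M b\<in>B. lborel) (\<Pi>\<^sub>M b\<in>B. lborel) (\<lambda>c. \<lambda>b\<in>B. t * c b))"
proof (rule lborel_product.PiM_eqI[symmetric])
  have [measurable]: "(\<lambda>c. \<lambda>b\<in>B. t * c b) \<in> (\<Pi>\<^sub>M b\<in>B. lborel :: real measure) \<rightarrow>\<^sub>M (\<Pi>\<^sub>M b\<in>B. lborel)"
    by (intro measurable_restrict) measurable
  fix X :: "_ \<Rightarrow> real set" assume X: "\<And>i. i \<in> B \<Longrightarrow> X i \<in> sets lborel"
  have Xt: "(*) t -` X i \<in> sets lborel" if "i \<in> B" for i
    using measurable_sets[of "(*) t" lborel lborel "X i"] X that by simp
  have "((\<lambda>c. \<lambda>b\<in>B. t * c b) -` Pi\<^sub>E B X) \<inter> space (\<Pi>\<^sub>M b\<in>B. lborel :: real measure) = Pi\<^sub>E B (\<lambda>b. (*) t -` X b)"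
    by (auto simp: space_PiM PiE_iff)
  moreover have "emeasure (\<Pi>\<^sub>M b\<in>B. lborel) (Pi\<^sub>E B (\<lambda>b. (*) t -` X b)) = (\<Prod>b\<in>B. emeasure lborel ((*) t -` X b))"
    by (intro lborel_product.emeasure_PiM fin Xt)
  moreover have "ennreal (t ^ card B) * \<dots> = (\<Prod>b\<in>B. emeasure lborel (X b))"
  proof -
    have "ennreal t * emeasure lborel ((*) t -` X b) = emeasure lborel (X b)" if "b \<in> B" for b
    proof -
      have "emeasure lborel ((*) t -` X b) = emeasure (distr lborel borel ((*) t)) (X b)"
        using X that by (subst emeasure_distr) auto
      also have "\<dots> = ennreal (inverse t) * emeasure lborel (X b)"
        using t X that by (simp add: lborel_distr_mult emeasure_density nn_integral_cmult_indicator)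
      finally show ?thesis
        using t by (simp add: mult.assoc[symmetric] ennreal_mult[symmetric])
    qed
    then have "(\<Prod>b\<in>B. emeasure lborel (X b)) = (\<Prod>b\<in>B. ennreal t * emeasure lborel ((*) t -` X b))"
      by (intro prod.cong) auto
    also have "\<dots> = ennreal t ^ card B * (\<Prod>b\<in>B. emeasure lborel ((*) t -` X b))"
      by (simp add: prod.distrib)
    finally show ?thesis
      using t by (simp add: ennreal_power)
  qed
  ultimately show "emeasure (scale_measure (t ^ card B) (distr (\<Pi>\<^sub>M b\<in>B. lborel) (\<Pi>\<^sub>M b\<in>B. lborel)
      (\<lambda>c. \<lambda>b\<in>B. t * c b))) (Pi\<^sub>E B X) = (\<Prod>b\<in>B. emeasure lborel (X b))"
    using X fin by (simp, subst emeasure_distr) (auto intro!: sets_PiM_I_finite)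
qed (use fin in simp_all)

lemma measurable_linear_combination [measurable]:
  "(\<lambda>c. \<Sum>b\<in>B. c b *\<^sub>R f b) \<in> (\<Pi>\<^sub>M b\<in>B. lborel :: real measure) \<rightarrow>\<^sub>M (borel :: 'a::euclidean_space measure)"
  by (intro borel_measurable_sum borel_measurable_scaleR measurable_component_singleton[THEN measurable_compose]) auto

lemma orthonormal_basis_of_inner:
  assumes "orthonormal_basis_of V B" "a \<in> B" "b \<in> B"
  shows "a \<bullet> b = (if a = b then 1 else 0)"
  using assms by (auto simp: orthonormal_basis_of_def pairwise_def orthogonal_def norm_eq_1)

lemma orthonormal_basis_of_independent:
  assumes "orthonormal_basis_of V (B::'a::euclidean_space set)"
  shows "independent B"
  using assms unfolding orthonormal_basis_of_def
  by (metis norm_zero pairwise_orthogonal_independent zero_neq_one)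

lemma orthonormal_basis_of_card:
  assumes "orthonormal_basis_of V (B::'a::euclidean_space set)"
  shows "finite B" "card B = dim V"
  using orthonormal_basis_of_independent[OF assms] assms independent_imp_finite
    dim_span_eq_card_independent[of B]
  by (auto simp: orthonormal_basis_of_def)

text \<open>A bijection from \<open>Basis\<close> to \<open>B\<close> extends to an orthogonal
  transformation, which preserves Lebesgue measure. Hence coordinates in any orthonormal basis of
  the whole space produce the same measure.\<close>

lemma lborel_eq_orthonormal_basis:
  assumes B: "orthonormal_basis_of UNIV (B::'a::euclidean_space set)"
  shows "distr (\<Pi>\<^sub>M b\<in>B. lborel) borel (\<lambda>c. \<Sum>b\<in>B. c b *\<^sub>R b) = lborel"
proof -
  obtain f where f: "bij_betw f (Basis::'a set) B"
    using orthonormal_basis_of_card[OF B] finite_same_card_bij[of Basis B] by auto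
  define T where "T x = (\<Sum>b\<in>Basis. (x \<bullet> b) *\<^sub>R f b)" for x
  have lin: "linear T"
    unfolding T_def by (intro linearI) (auto simp: inner_add_left scaleR_add_left sum.distrib scaleR_sum_right)
  have ff: "f a \<bullet> f b = (if a = b then 1 else 0)" if "a \<in> Basis" "b \<in> Basis" for a b
    using f that by (subst orthonormal_basis_of_inner[OF B]) (auto simp: bij_betw_def inj_on_def)
  have "T x \<bullet> T y = x \<bullet> y" for x y
  proof -
    have "T x \<bullet> T y = (\<Sum>a\<in>Basis. \<Sum>b\<in>Basis. (x \<bullet> a) * ((y \<bullet> b) * (f a \<bullet> f b)))"
      unfolding T_def inner_sum_left inner_sum_right
      by (subst sum.swap) (simp add: mult.left_commute mult.commute)
    also have "\<dots> = (\<Sum>a\<in>Basis. \<Sum>b\<in>Basis. if b = a then (x \<bullet> a) * (y \<bullet> b) else 0)"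
      by (intro sum.cong) (auto simp: ff)
    also have "\<dots> = x \<bullet> y"
      by (simp add: euclidean_inner[of x y])
    finally show ?thesis .
  qed
  then have T: "orthogonal_transformation T"
    using lin by (auto simp: orthogonal_transformation_def)
  have fB: "f a \<in> B" if "a \<in> Basis" for a
    using f that by (auto simp: bij_betw_def)
  have [measurable]: "T \<in> borel_measurable borel"
    unfolding T_def by measurable
  have [measurable]: "(\<lambda>c. \<lambda>a\<in>Basis. c (f a)) \<in> (\<Pi>\<^sub>M b\<in>B. lborel :: real measure) \<rightarrow>\<^sub>M (\<Pi>\<^sub>M a\<in>Basis. lborel)"
    by (intro measurable_restrict measurable_component_singleton fB)
  \<comment> \<open>The standard coordinates are followed by \<open>T\<close>, which replaces each
    \<open>b\<close> by \<open>f b\<close>; the index set is then relabelled from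
    \<open>Basis\<close> to \<open>B\<close>.\<close>
  have "lborel = distr (distr (\<Pi>\<^sub>M b\<in>Basis. lborel) borel (\<lambda>c. \<Sum>b\<in>Basis. c b *\<^sub>R b)) borel T"
    using distr_lborel_orthogonal_transformation[OF T] by (simp add: lborel_eq[symmetric])
  also have "\<dots> = distr (\<Pi>\<^sub>M b\<in>Basis. lborel) borel (\<lambda>c. T (\<Sum>b\<in>Basis. c b *\<^sub>R b))"
    by (subst distr_distr) (simp_all add: comp_def)
  also have "(\<lambda>c. T (\<Sum>b\<in>Basis. c b *\<^sub>R b)) = (\<lambda>c. \<Sum>b\<in>Basis. c b *\<^sub>R f b)"
    unfolding T_def by (intro ext sum.cong) simp_all
  also have "distr (\<Pi>\<^sub>M b\<in>Basis. lborel) borel \<dots>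
      = distr (distr (\<Pi>\<^sub>M b\<in>B. lborel) (\<Pi>\<^sub>M a\<in>Basis. lborel) (\<lambda>c. \<lambda>a\<in>Basis. c (f a))) borel
          (\<lambda>c. \<Sum>b\<in>Basis. c b *\<^sub>R f b)"
    by (simp only: distr_PiM_lborel_reindex[OF f finite_Basis])
  also have "\<dots> = distr (\<Pi>\<^sub>M b\<in>B. lborel) borel (\<lambda>c. \<Sum>a\<in>Basis. c (f a) *\<^sub>R f a)"
    by (subst distr_distr) (simp_all add: comp_def)
  also have "(\<lambda>c :: 'a \<Rightarrow> real. \<Sum>a\<in>Basis. c (f a) *\<^sub>R f a) = (\<lambda>c. \<Sum>b\<in>B. c b *\<^sub>R b)"
    by (intro ext sum.reindex_bij_betw[OF f])
  finally show ?thesis ..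
qed

section \<open>Lebesgue measure on subspaces and orthogonal splittings\<close>

lemma orthonormal_basis_of_exists:
  assumes "subspace (V::'a::euclidean_space set)"
  shows "\<exists>B. orthonormal_basis_of V B"
  using orthonormal_basis_subspace[OF assms] unfolding orthonormal_basis_of_def by metis

text \<open>On Borel sets the completion changes nothing, so the definition reduces to a product
  measure of coordinates. The chosen basis is obtained once and serves every Borel set
  \<open>A\<close>.\<close>

lemma measure_subspace_lebesgue:
  assumes "subspace (V::'a::euclidean_space set)"
  obtains B where "orthonormal_basis_of V B"
    "\<And>A. A \<in> sets borel \<Longrightarrow> measure (subspace_lebesgue V) A
      = measure (\<Pi>\<^sub>M b\<in>B. lborel) ((\<lambda>c. \<Sum>b\<in>B. c b *\<^sub>R b) -` A \<inter> space (\<Pi>\<^sub>M b\<in>B. lborel :: real measure))"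
proof
  define B where "B = (SOME B. orthonormal_basis_of V B)"
  show "orthonormal_basis_of V B"
    unfolding B_def using orthonormal_basis_of_exists[OF assms] by (rule someI_ex)
  fix A :: "'a set" assume A: "A \<in> sets borel"
  have "measure (subspace_lebesgue V) A = measure (distr (\<Pi>\<^sub>M b\<in>B. lborel) borel (\<lambda>c. \<Sum>b\<in>B. c b *\<^sub>R b)) A"
    using A by (simp add: subspace_lebesgue_def B_def[symmetric] Let_def)
  also have "\<dots> = measure (\<Pi>\<^sub>M b\<in>B. lborel) ((\<lambda>c. \<Sum>b\<in>B. c b *\<^sub>R b) -` A \<inter> space (\<Pi>\<^sub>M b\<in>B. lborel :: real measure))"
    using A by (intro measure_distr) auto
  finally show "measure (subspace_lebesgue V) A
      = measure (\<Pi>\<^sub>M b\<in>B. lborel) ((\<lambda>c. \<Sum>b\<in>B. c b *\<^sub>R b) -` A \<inter> space (\<Pi>\<^sub>M b\<in>B. lborel :: real measure))" .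
qed

lemma orthogonal_sum_unique:
  assumes "subspace (V::'a::euclidean_space set)" "x \<in> V" "x' \<in> V"
    "y \<in> orthogonal_comp V" "y' \<in> orthogonal_comp V" "x + y = x' + y'"
  shows "x = x'" "y = y'"
proof -
  have "x - x' = y' - y"
    using assms(6) by (simp add: algebra_simps)
  moreover have "x - x' \<in> V" "y' - y \<in> orthogonal_comp V"
    using assms by (auto intro: subspace_diff subspace_orthogonal_comp)
  ultimately have "x - x' \<in> V \<inter> orthogonal_comp V"
    by simp
  then show "x = x'" "y = y'"
    using orthogonal_Int_0[OF assms(1)] \<open>x - x' = y' - y\<close> by auto
qed

lemma orthonormal_basis_of_Un:
  assumes V: "subspace (V::'a::euclidean_space set)"
    and B: "orthonormal_basis_of V B" and C: "orthonormal_basis_of (orthogonal_comp V) C"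
  shows "orthonormal_basis_of UNIV (B \<union> C)" "B \<inter> C = {}"
proof -
  have BV: "B \<subseteq> V" and CV: "C \<subseteq> orthogonal_comp V"
    using B C span_superset unfolding orthonormal_basis_of_def by blast+
  then have orth: "orthogonal b c" "orthogonal c b" if "b \<in> B" "c \<in> C" for b c
    using that BV CV unfolding orthogonal_comp_def orthogonal_commute[of c b] by auto
  have "span (B \<union> C) = UNIV"
  proof -
    have "v \<in> span (B \<union> C)" for v
    proof -
      obtain x y where "v = x + y" "x \<in> V" "y \<in> orthogonal_comp V"
        using subspace_sum_orthogonal_comp[OF V] set_plus_elim by blast
      moreover have "V \<subseteq> span (B \<union> C)" "orthogonal_comp V \<subseteq> span (B \<union> C)"
        using B C span_mono[of B "B \<union> C"] span_mono[of C "B \<union> C"]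
        unfolding orthonormal_basis_of_def by auto
      ultimately show ?thesis
        by (auto intro: span_add)
    qed
    then show ?thesis by auto
  qed
  moreover have "pairwise orthogonal (B \<union> C)"
    using B C orth unfolding orthonormal_basis_of_def pairwise_def by blast
  ultimately show "orthonormal_basis_of UNIV (B \<union> C)"
    using B C unfolding orthonormal_basis_of_def by auto
  show "B \<inter> C = {}"
    using orth B unfolding orthonormal_basis_of_def by (fastforce simp: orthogonal_self)
qed

text \<open>Orthonormal bases of \<open>V\<close> and of its complement join to one of the whole
  space, and the product measure splits over the two disjoint index sets. By uniqueness of the
  splitting the coordinate set of the sum is a rectangle; compactness makes all three sets
  Borel.\<close>

lemma measure_orthogonal_sum:
  assumes V: "subspace (V::'a::euclidean_space set)"
    and A: "A \<subseteq> V" "compact A" and D: "D \<subseteq> orthogonal_comp V" "compact D"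
  shows "measure lebesgue {x + y | x y. x \<in> A \<and> y \<in> D}
    = measure (subspace_lebesgue V) A * measure (subspace_lebesgue (orthogonal_comp V)) D"
proof -
  obtain B where B: "orthonormal_basis_of V B"
    and mB: "\<And>A. A \<in> sets borel \<Longrightarrow> measure (subspace_lebesgue V) A
      = measure (\<Pi>\<^sub>M b\<in>B. lborel) ((\<lambda>c. \<Sum>b\<in>B. c b *\<^sub>R b) -` A \<inter> space (\<Pi>\<^sub>M b\<in>B. lborel :: real measure))"
    using measure_subspace_lebesgue[OF V] by blast
  obtain C where C: "orthonormal_basis_of (orthogonal_comp V) C"
    and mC: "\<And>A. A \<in> sets borel \<Longrightarrow> measure (subspace_lebesgue (orthogonal_comp V)) A
      = measure (\<Pi>\<^sub>M b\<in>C. lborel) ((\<lambda>c. \<Sum>b\<in>C. c b *\<^sub>R b) -` A \<inter> space (\<Pi>\<^sub>M b\<in>C. lborel :: real measure))"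
    using measure_subspace_lebesgue[OF subspace_orthogonal_comp] by blast
  note Un = orthonormal_basis_of_Un[OF V B C]
  note fin = orthonormal_basis_of_card(1)[OF B] orthonormal_basis_of_card(1)[OF C]
  let ?P = "\<lambda>B. \<Pi>\<^sub>M b\<in>B. lborel :: real measure"
  let ?g = "\<lambda>B c. \<Sum>b\<in>B. c b *\<^sub>R b :: 'a"
  interpret C: sigma_finite_measure "?P C"
    by (intro lborel_product.sigma_finite fin)
  let ?S = "{x + y | x y. x \<in> A \<and> y \<in> D}"
  have S: "?S \<in> sets borel"
    using compact_sums[OF A(2) D(2)] by (simp add: borel_compact)
  have AD: "A \<in> sets borel" "D \<in> sets borel"
    using A D by (auto simp: borel_compact)
  have gV: "?g B c \<in> V" and gC: "?g C c \<in> orthogonal_comp V" for c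
    using B C V subspace_orthogonal_comp[of V] span_superset[of B] span_superset[of C]
    unfolding orthonormal_basis_of_def
    by (auto intro!: subspace_sum subspace_scale)
  \<comment> \<open>\<open>merge\<close> glues the coordinates of the two components, which is the
    form in which the product measure over \<open>B \<union> C\<close> factors.\<close>
  have split: "?g (B \<union> C) (merge B C (c, d)) = ?g B c + ?g C d" for c d
  proof -
    have "?g (B \<union> C) (merge B C (c, d)) = ?g B (merge B C (c, d)) + ?g C (merge B C (c, d))"
      using fin Un(2) by (rule sum.union_disjoint)
    also have "?g B (merge B C (c, d)) = ?g B c"
      by (intro sum.cong) (auto simp: merge_def)
    also have "?g C (merge B C (c, d)) = ?g C d"
      using Un(2) by (intro sum.cong) (auto simp: merge_def)
    finally show ?thesis .
  qed
  have mem: "?g B c + ?g C d \<in> ?S \<longleftrightarrow> ?g B c \<in> A \<and> ?g C d \<in> D" for c d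
  proof
    assume "?g B c + ?g C d \<in> ?S"
    then obtain x y where xy: "?g B c + ?g C d = x + y" "x \<in> A" "y \<in> D"
      by blast
    then have "x \<in> V" "y \<in> orthogonal_comp V"
      using A(1) D(1) by auto
    then show "?g B c \<in> A \<and> ?g C d \<in> D"
      using orthogonal_sum_unique[OF V gV _ gC _ xy(1)] xy(2,3) by simp
  qed blast
  have "emeasure lborel ?S = emeasure (distr (?P (B \<union> C)) borel (?g (B \<union> C))) ?S"
    by (simp add: lborel_eq_orthonormal_basis[OF Un(1)])
  also have "\<dots> = emeasure (distr (distr (?P B \<Otimes>\<^sub>M ?P C) (?P (B \<union> C)) (merge B C)) borel (?g (B \<union> C))) ?S"
    by (simp only: lborel_product.distr_merge[OF Un(2) fin])
  also have "\<dots> = emeasure (distr (?P B \<Otimes>\<^sub>M ?P C) borel (\<lambda>cd. ?g (B \<union> C) (merge B C cd))) ?S"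
    by (subst distr_distr) (auto simp: comp_def)
  also have "\<dots> = emeasure (?P B \<Otimes>\<^sub>M ?P C)
      ((\<lambda>cd. ?g (B \<union> C) (merge B C cd)) -` ?S \<inter> space (?P B \<Otimes>\<^sub>M ?P C))"
    using S by (intro emeasure_distr) auto
  also have "(\<lambda>cd. ?g (B \<union> C) (merge B C cd)) -` ?S \<inter> space (?P B \<Otimes>\<^sub>M ?P C)
      = (?g B -` A \<inter> space (?P B)) \<times> (?g C -` D \<inter> space (?P C))"
  proof (rule set_eqI)
    fix cd :: "('a \<Rightarrow> real) \<times> ('a \<Rightarrow> real)"
    obtain c d where cd: "cd = (c, d)"
      by fastforce
    show "cd \<in> (\<lambda>cd. ?g (B \<union> C) (merge B C cd)) -` ?S \<inter> space (?P B \<Otimes>\<^sub>M ?P C)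
        \<longleftrightarrow> cd \<in> (?g B -` A \<inter> space (?P B)) \<times> (?g C -` D \<inter> space (?P C))"
      unfolding cd vimage_eq Int_iff mem_Times_iff space_pair_measure fst_conv snd_conv split mem by blast
  qed
  also have "emeasure (?P B \<Otimes>\<^sub>M ?P C) \<dots>
      = emeasure (?P B) (?g B -` A \<inter> space (?P B)) * emeasure (?P C) (?g C -` D \<inter> space (?P C))"
    using AD by (intro C.emeasure_pair_measure_Times measurable_sets[OF measurable_linear_combination])
  finally have "measure lborel ?S
      = measure (?P B) (?g B -` A \<inter> space (?P B)) * measure (?P C) (?g C -` D \<inter> space (?P C))"
    by (simp add: measure_def enn2real_mult)
  then show ?thesis
    using S AD by (simp add: mB mC)
qed

text \<open>Dilation in \<open>V\<close> is multiplication by \<open>t\<close> in every coordinate,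
  and there are \<open>dim V\<close> coordinates.\<close>

lemma measure_subspace_lebesgue_scale:
  assumes V: "subspace (V::'a::euclidean_space set)" and A: "A \<in> sets borel" and t: "t > 0"
  shows "measure (subspace_lebesgue V) ((*\<^sub>R) t ` A) = t ^ dim V * measure (subspace_lebesgue V) A"
proof -
  obtain B where B: "orthonormal_basis_of V B"
    and mB: "\<And>A. A \<in> sets borel \<Longrightarrow> measure (subspace_lebesgue V) A
      = measure (\<Pi>\<^sub>M b\<in>B. lborel) ((\<lambda>c. \<Sum>b\<in>B. c b *\<^sub>R b) -` A \<inter> space (\<Pi>\<^sub>M b\<in>B. lborel :: real measure))"
    using measure_subspace_lebesgue[OF V] by blast
  note cardB = orthonormal_basis_of_card[OF B]
  let ?P = "\<Pi>\<^sub>M b\<in>B. lborel :: real measure"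
  let ?g = "\<lambda>c. \<Sum>b\<in>B. c b *\<^sub>R b :: 'a"
  let ?s = "\<lambda>c. \<lambda>b\<in>B. t * c b"
  \<comment> \<open>Measurability is available for preimages, so the dilated set is rewritten as a
    preimage under the inverse dilation.\<close>
  have tA_vimage: "(*\<^sub>R) t ` A = (*\<^sub>R) (inverse t) -` A"
    using t by (force simp: image_iff)
  have tA: "(*\<^sub>R) t ` A \<in> sets borel"
    unfolding tA_vimage using measurable_sets[of "(*\<^sub>R) (inverse t)" borel borel A] A by simp
  have [measurable]: "?s \<in> ?P \<rightarrow>\<^sub>M ?P"
    by (intro measurable_restrict) measurable
  have g_scale: "?g (?s c) = t *\<^sub>R ?g c" for c
    by (simp add: scaleR_sum_right)
  have "measure ?P (?g -` ((*\<^sub>R) t ` A) \<inter> space ?P)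
      = measure (scale_measure (t ^ card B) (distr ?P ?P ?s)) (?g -` ((*\<^sub>R) t ` A) \<inter> space ?P)"
    using distr_PiM_lborel_scale[OF cardB(1) t] by simp
  also have "\<dots> = t ^ card B * measure (distr ?P ?P ?s) (?g -` ((*\<^sub>R) t ` A) \<inter> space ?P)"
    using t by (intro measure_scale_measure) simp
  also have "measure (distr ?P ?P ?s) (?g -` ((*\<^sub>R) t ` A) \<inter> space ?P)
      = measure ?P (?s -` (?g -` ((*\<^sub>R) t ` A) \<inter> space ?P) \<inter> space ?P)"
    using tA by (intro measure_distr measurable_sets[OF measurable_linear_combination]) auto
  also have "?s -` (?g -` ((*\<^sub>R) t ` A) \<inter> space ?P) \<inter> space ?P = ?g -` A \<inter> space ?P"
    using t g_scale by (auto simp: space_PiM simp del: restrict_apply)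
  finally show ?thesis
    using tA A cardB by (simp add: mB)
qed

section \<open>Orthogonal projections and sublevel sets of norms\<close>

text \<open>The orthogonal splitting is unique, so the definite description denotes. Identities for
  projections follow by exhibiting a candidate.\<close>

lemma orth_proj_unique:
  assumes V: "subspace (V::'a::euclidean_space set)" and "y \<in> V" "x - y \<in> orthogonal_comp V"
  shows "orth_proj V x = y"
  unfolding orth_proj_def
proof (rule the_equality)
  show "z = y" if "z \<in> V \<and> x - z \<in> orthogonal_comp V" for z
    using orthogonal_sum_unique(1)[OF V, of z y "x - z" "x - y"] that assms by simp
qed (use assms in simp)

lemma orth_proj_in:
  assumes V: "subspace (V::'a::euclidean_space set)"
  shows "orth_proj V x \<in> V" "x - orth_proj V x \<in> orthogonal_comp V"
proof -
  obtain y z where "x = y + z" "y \<in> V" "z \<in> orthogonal_comp V"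
    using subspace_sum_orthogonal_comp[OF V] set_plus_elim by blast
  then have "orth_proj V x = y \<and> y \<in> V \<and> x - y \<in> orthogonal_comp V"
    using orth_proj_unique[OF V, of y x] by simp
  then show "orth_proj V x \<in> V" "x - orth_proj V x \<in> orthogonal_comp V"
    by auto
qed

lemma linear_orth_proj:
  assumes V: "subspace (V::'a::euclidean_space set)"
  shows "linear (orth_proj V)"
proof (rule linearI)
  note P = orth_proj_in[OF V] and C = subspace_orthogonal_comp[of V]
  show "orth_proj V (x + y) = orth_proj V x + orth_proj V y" for x y
    using subspace_add[OF C P(2)[of x] P(2)[of y]]
    by (intro orth_proj_unique V subspace_add P) (simp add: algebra_simps)
  show "orth_proj V (c *\<^sub>R x) = c *\<^sub>R orth_proj V x" for c x
    using subspace_scale[OF C P(2)[of x], of c]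
    by (intro orth_proj_unique V subspace_scale P) (simp add: algebra_simps)
qed

section \<open>Arbitrary norms: continuity, compact sublevel sets and scaling\<close>

lemma is_norm_zero: "is_norm f \<Longrightarrow> f 0 = 0"
  unfolding is_norm_def by blast

lemma is_norm_sum_le:
  assumes "is_norm f" "finite A"
  shows "f (\<Sum>a\<in>A. g a) \<le> (\<Sum>a\<in>A. f (g a))"
  using assms(2)
proof (induction rule: finite_induct)
  case empty
  show ?case by (simp add: is_norm_zero assms(1))
next
  case (insert a A)
  have "f (g a + sum g A) \<le> f (g a) + f (sum g A)"
    using assms(1) by (simp add: is_norm_def)
  with insert show ?case by simp
qed

lemma is_norm_minus: "is_norm f \<Longrightarrow> f (- x) = f x"
  by (metis abs_minus_cancel abs_one is_norm_def mult_1 scaleR_minus1_left)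

lemma is_norm_diff_le:
  assumes "is_norm f"
  shows "\<bar>f x - f y\<bar> \<le> f (x - y)"
proof -
  have tri: "f (u + v) \<le> f u + f v" for u v
    using assms by (simp add: is_norm_def)
  have "f x \<le> f (x - y) + f y" "f y \<le> f (y - x) + f x" "f (y - x) = f (x - y)"
    using tri[of "x - y" y] tri[of "y - x" x] is_norm_minus[OF assms, of "x - y"] by simp_all
  then show ?thesis by linarith
qed

text \<open>Expanding in \<open>Basis\<close> bounds \<open>f\<close> by \<open>L\<close> times the
  Euclidean norm, \<open>L\<close> being the sum of \<open>f\<close> over \<open>Basis\<close>. The
  reverse triangle inequality then makes \<open>f\<close> Lipschitz with constant
  \<open>L\<close>.\<close>

lemma is_norm_continuous:
  fixes f :: "'a::euclidean_space \<Rightarrow> real"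
  assumes f: "is_norm f"
  shows "continuous_on S f"
proof -
  define L where "L = (\<Sum>b\<in>Basis. f b)"
  have L: "f x \<le> L * norm x" for x :: 'a
  proof -
    have "f x = f (\<Sum>b\<in>Basis. (x \<bullet> b) *\<^sub>R b)"
      by (simp add: euclidean_representation)
    also have "\<dots> \<le> (\<Sum>b\<in>Basis. f ((x \<bullet> b) *\<^sub>R b))"
      by (intro is_norm_sum_le f) simp
    also have "\<dots> \<le> (\<Sum>b\<in>Basis. f b * norm x)"
    proof (rule sum_mono)
      fix b :: 'a assume "b \<in> Basis"
      then have "\<bar>x \<bullet> b\<bar> * f b \<le> norm x * f b"
        using f by (intro mult_right_mono Basis_le_norm) (auto simp: is_norm_def)
      then show "f ((x \<bullet> b) *\<^sub>R b) \<le> f b * norm x"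
        using f by (simp add: is_norm_def mult.commute)
    qed
    finally show ?thesis by (simp add: L_def sum_distrib_right)
  qed
  have "L \<ge> 0"
    using f unfolding L_def by (intro sum_nonneg) (auto simp: is_norm_def)
  then have "L-lipschitz_on S f"
    using is_norm_diff_le[OF f] L
    by (intro lipschitz_onI) (auto simp: dist_norm intro: order_trans)
  then show ?thesis
    by (rule lipschitz_on_continuous_on)
qed

text \<open>The constant \<open>c\<close> is the minimum of \<open>f\<close> on the unit sphere,
  positive because it is attained at a nonzero point; homogeneity extends the bound to all
  vectors.\<close>

lemma is_norm_lower_bound:
  fixes f :: "'a::euclidean_space \<Rightarrow> real"
  assumes f: "is_norm f"
  obtains c where "c > 0" "\<And>x. c * norm x \<le> f x"
proof -
  have "\<exists>c>0. \<forall>x\<in>sphere 0 1. c \<le> f x"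
  proof -
    have "sphere (0::'a) 1 \<noteq> {}" by simp
    then obtain z where z: "z \<in> sphere 0 1" "\<And>x. x \<in> sphere 0 1 \<Longrightarrow> f z \<le> f x"
      using continuous_attains_inf[OF compact_sphere _ is_norm_continuous[OF f]] by blast
    have "z \<noteq> 0" using z(1) by auto
    then have "f z > 0"
      using f by (metis is_norm_def less_eq_real_def)
    then show ?thesis using z(2) by blast
  qed
  then obtain c where c: "c > 0" "\<And>x. x \<in> sphere 0 1 \<Longrightarrow> c \<le> f x"
    by blast
  have "c * norm x \<le> f x" for x
  proof (cases "x = 0")
    case True
    then show ?thesis using f by (simp add: is_norm_def)
  next
    case False
    then have "c \<le> f ((1 / norm x) *\<^sub>R x)"
      by (intro c) simp
    also have "\<dots> = f x / norm x"
      using f by (simp add: is_norm_def)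
    finally show ?thesis using False by (simp add: field_simps)
  qed
  with c(1) that show ?thesis by blast
qed

lemma compact_sublevel:
  fixes f :: "'a::euclidean_space \<Rightarrow> real"
  assumes f: "is_norm f"
  shows "compact (sublevel f t)"
proof -
  obtain c where c: "c > 0" "\<And>x. c * norm x \<le> f x"
    using is_norm_lower_bound[OF f] by blast
  have "norm x \<le> t / c" if "x \<in> sublevel f t" for x
    using c(2)[of x] c(1) that by (simp add: sublevel_def field_simps)
  then have "bounded (sublevel f t)"
    by (auto simp: bounded_iff)
  moreover have "closed (sublevel f t)"
    unfolding sublevel_def
    by (intro closed_Collect_le is_norm_continuous f continuous_on_const)
  ultimately show ?thesis by (simp add: compact_eq_bounded_closed)
qed

lemma sublevel_scale:
  assumes f: "is_norm f" and t: "t > 0"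
  shows "sublevel f t = (*\<^sub>R) t ` sublevel f 1"
proof (intro subset_antisym subsetI)
  fix x assume "x \<in> sublevel f t"
  then have "(1 / t) *\<^sub>R x \<in> sublevel f 1" "x = t *\<^sub>R ((1 / t) *\<^sub>R x)"
    using f t by (auto simp: sublevel_def is_norm_def)
  then show "x \<in> (*\<^sub>R) t ` sublevel f 1" by blast
next
  fix x assume "x \<in> (*\<^sub>R) t ` sublevel f 1"
  then show "x \<in> sublevel f t"
    using f t by (auto simp: sublevel_def is_norm_def)
qed

lemma measure_subspace_sublevel:
  assumes V: "subspace (V::'a::euclidean_space set)" and f: "is_norm f" and t: "t > 0"
  shows "measure (subspace_lebesgue V) (V \<inter> sublevel f t)
    = t ^ dim V * measure (subspace_lebesgue V) (V \<inter> sublevel f 1)"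
proof -
  have "V \<inter> sublevel f t = (*\<^sub>R) t ` (V \<inter> sublevel f 1)"
  proof -
    have "t *\<^sub>R v \<in> V \<longleftrightarrow> v \<in> V" for v
      using subspace_scale[OF V, of "t *\<^sub>R v" "1 / t"] subspace_scale[OF V, of v t] t by auto
    then show ?thesis
      unfolding sublevel_scale[OF f t] by blast
  qed
  moreover have "V \<inter> sublevel f 1 \<in> sets borel"
    using compact_sublevel[OF f, of 1] closed_subspace[OF V] by (intro sets.Int borel_compact borel_closed)
  ultimately show ?thesis
    using measure_subspace_lebesgue_scale[OF V _ t] by simp
qed

lemma compact_proj_sublevel:
  assumes "subspace (V::'a::euclidean_space set)" "is_norm f"
  shows "compact (orth_proj V ` sublevel f t)"
  using compact_sublevel[OF assms(2)] linear_orth_proj[OF assms(1)]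
  by (intro compact_continuous_image linear_continuous_on) (simp_all add: linear_conv_bounded_linear)

lemma measure_subspace_proj_sublevel:
  assumes V: "subspace (V::'a::euclidean_space set)" and f: "is_norm f" and t: "t > 0"
  shows "measure (subspace_lebesgue V) (orth_proj V ` sublevel f t)
    = t ^ dim V * measure (subspace_lebesgue V) (orth_proj V ` sublevel f 1)"
proof -
  have "orth_proj V ` sublevel f t = (*\<^sub>R) t ` orth_proj V ` sublevel f 1"
    unfolding sublevel_scale[OF f t] image_image linear_scale[OF linear_orth_proj[OF V]] ..
  moreover have "orth_proj V ` sublevel f 1 \<in> sets borel"
    by (intro borel_compact compact_proj_sublevel V f)
  ultimately show ?thesis
    using measure_subspace_lebesgue_scale[OF V _ t] by simp
qed

section \<open>Cylinders\<close>

lemma subspace_spanT: "subspace (spanT \<psi> J)"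
  by (simp add: spanT_def)

text \<open>Bases of \<open>V\<close> and its complement are disjoint and together form a basis of
  the space, so their cardinalities add up to the dimension.\<close>

lemma dim_orthogonal_comp:
  assumes V: "subspace (V::'a::euclidean_space set)"
  shows "dim (orthogonal_comp V) = DIM('a) - dim V"
proof -
  obtain B C where B: "orthonormal_basis_of V B" and C: "orthonormal_basis_of (orthogonal_comp V) C"
    using orthonormal_basis_of_exists[OF V] orthonormal_basis_of_exists[OF subspace_orthogonal_comp] by blast
  note Un = orthonormal_basis_of_Un[OF V B C]
  note cards = orthonormal_basis_of_card[OF B] orthonormal_basis_of_card[OF C] orthonormal_basis_of_card[OF Un(1)]
  have "card (B \<union> C) = card B + card C"
    using Un(2) cards by (intro card_Un_disjoint)
  then show ?thesis
    using cards by simp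
qed

text \<open>A vector and its projection to the complement differ by an element of the span, which
  the first summand absorbs. The form without projection shows that a cylinder depends only on the
  span and grows with it.\<close>

lemma cylT_eq_sums:
  fixes \<psi> :: "'i \<Rightarrow> 'a::euclidean_space"
  shows "cylT nrm \<psi> J \<tau> = {x + w | x w. x \<in> spanT \<psi> J \<and> w \<in> sublevel nrm \<tau>}"
proof -
  let ?V = "spanT \<psi> J" and ?P = "orth_proj (orthogonal_comp (spanT \<psi> J))"
  have V: "subspace ?V" by (rule subspace_spanT)
  have P: "w - ?P w \<in> ?V" for w
    using orth_proj_in(2)[OF subspace_orthogonal_comp] orthogonal_comp_self[OF V] by blast
  show ?thesis
  proof (intro subset_antisym subsetI)
    fix d assume "d \<in> cylT nrm \<psi> J \<tau>"
    then obtain x w where d: "d = x + ?P w" "x \<in> ?V" "w \<in> sublevel nrm \<tau>"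
      unfolding cylT_def by blast
    have "d = (x - (w - ?P w)) + w"
      using d by simp
    moreover have "x - (w - ?P w) \<in> ?V"
      using subspace_diff[OF V d(2) P] .
    ultimately show "d \<in> {x + w | x w. x \<in> ?V \<and> w \<in> sublevel nrm \<tau>}"
      using d(3) by blast
  next
    fix d assume "d \<in> {x + w | x w. x \<in> ?V \<and> w \<in> sublevel nrm \<tau>}"
    then obtain x w where d: "d = x + w" "x \<in> ?V" "w \<in> sublevel nrm \<tau>"
      by blast
    have "d = (x + (w - ?P w)) + ?P w"
      using d by simp
    moreover have "x + (w - ?P w) \<in> ?V"
      using subspace_add[OF V d(2) P] .
    ultimately show "d \<in> cylT nrm \<psi> J \<tau>"
      using d(3) unfolding cylT_def by blast
  qed
qed

lemma closed_cylT:
  fixes \<psi> :: "'i \<Rightarrow> 'a::euclidean_space"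
  assumes "is_norm nrm"
  shows "closed (cylT nrm \<psi> J \<tau>)"
proof -
  have "closed (\<Union>x\<in>spanT \<psi> J. \<Union>y\<in>sublevel nrm \<tau>. {x + y})"
    by (intro closed_compact_sums closed_subspace subspace_spanT compact_sublevel assms)
  also have "(\<Union>x\<in>spanT \<psi> J. \<Union>y\<in>sublevel nrm \<tau>. {x + y}) = cylT nrm \<psi> J \<tau>"
    unfolding cylT_eq_sums by blast
  finally show ?thesis .
qed

text \<open>A cylinder over a nonzero span is unbounded. Truncation makes it compact, hence of
  finite measure, as monotonicity of the real-valued \<open>measure\<close> requires.\<close>

lemma lmeasurable_cylT_Int_sublevel:
  fixes \<psi> :: "'i \<Rightarrow> 'a::euclidean_space"
  assumes "is_norm nrm" "is_norm fd"
  shows "cylT nrm \<psi> J \<tau> \<inter> sublevel fd \<theta> \<in> lmeasurable"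
  by (intro lmeasurable_compact closed_Int_compact closed_cylT compact_sublevel assms)

text \<open>The number \<open>\<tau>\<close> itself belongs to the set whose infimum is taken,
  because projection commutes with scaling by \<open>1 / \<tau>\<close>.\<close>

lemma proj_norm_le:
  fixes \<psi> :: "'i \<Rightarrow> 'a::euclidean_space"
  assumes nrm: "is_norm nrm" and \<tau>: "\<tau> > 0"
    and u: "u \<in> orth_proj (orthogonal_comp (spanT \<psi> J)) ` sublevel nrm \<tau>"
  shows "proj_norm nrm \<psi> J u \<le> \<tau>"
proof -
  let ?P = "orth_proj (orthogonal_comp (spanT \<psi> J))"
  obtain w where w: "u = ?P w" "w \<in> sublevel nrm \<tau>"
    using u by blast
  have "(1 / \<tau>) *\<^sub>R u = ?P ((1 / \<tau>) *\<^sub>R w)"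
    unfolding w(1) linear_scale[OF linear_orth_proj[OF subspace_orthogonal_comp]] ..
  moreover have "(1 / \<tau>) *\<^sub>R w \<in> sublevel nrm 1"
    using w(2) \<tau> nrm by (simp add: sublevel_def is_norm_def)
  ultimately have "(1 / \<tau>) *\<^sub>R u \<in> ?P ` sublevel nrm 1"
    by blast
  then show ?thesis
    unfolding proj_norm_def using \<tau> by (intro cInf_lower) (auto intro!: bdd_belowI[of _ 0])
qed

text \<open>This covers radius \<open>0\<close>, which occurs when
  \<open>\<theta> = \<delta>J * \<tau>\<close>. There the left side vanishes if
  \<open>dim V > 0\<close>; if \<open>dim V = 0\<close>, both sublevel sets meet \<open>V\<close> in
  \<open>{0}\<close> and the factor is \<open>0 ^ 0 = 1\<close>.\<close>

lemma measure_subspace_sublevel_ge: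
  assumes V: "subspace (V::'a::euclidean_space set)" and f: "is_norm f" and t: "t \<ge> 0"
  shows "t ^ dim V * measure (subspace_lebesgue V) (V \<inter> sublevel f 1)
    \<le> measure (subspace_lebesgue V) (V \<inter> sublevel f t)"
proof -
  consider "t > 0" | "t = 0" "dim V > 0" | "t = 0" "dim V = 0"
    using t by fastforce
  then show ?thesis
  proof cases
    case 1
    show ?thesis using measure_subspace_sublevel[OF V f 1] by simp
  next
    case 2
    then show ?thesis by (simp add: zero_power)
  next
    case 3
    then have "V \<subseteq> {0}" by (simp add: dim_eq_0)
    then have "V \<inter> sublevel f s = {0}" if "s \<ge> 0" for s
      using subspace_0[OF V] is_norm_zero[OF f] that by (auto simp: sublevel_def)
    then show ?thesis using 3 by (simp del: dim_eq_0)
  qed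
qed

text \<open>On \<open>V + P(L(\<tau>))\<close> the second summand has \<open>fd\<close>-norm at most \<open>\<delta>J * \<tau>\<close>, which squeezes the
  truncated cylinder between two sums of a ball in \<open>V\<close> and the fixed cross section.\<close>

lemma cylinder_measure_bounds:
  fixes \<psi> :: "'i \<Rightarrow> 'a::euclidean_space"
  assumes nrm: "is_norm nrm" and fd: "is_norm fd"
    and \<delta>J: "\<delta>J \<ge> 0"
      "\<And>u. u \<in> orthogonal_comp (spanT \<psi> J) \<Longrightarrow> fd u \<le> \<delta>J * proj_norm nrm \<psi> J u"
    and dimJ: "dim (spanT \<psi> J) = K" and \<tau>: "\<tau> > 0" and \<theta>: "\<theta> > 0"
  shows "measure lebesgue (cylT nrm \<psi> J \<tau> \<inter> sublevel fd \<theta>)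
      \<le> const_C nrm fd \<psi> J * \<tau> ^ (DIM('a) - K) * (\<theta> + \<delta>J * \<tau>) ^ K" (is ?upper)
    and "\<theta> \<ge> \<delta>J * \<tau> \<Longrightarrow> const_C nrm fd \<psi> J * \<tau> ^ (DIM('a) - K) * (\<theta> - \<delta>J * \<tau>) ^ K
      \<le> measure lebesgue (cylT nrm \<psi> J \<tau> \<inter> sublevel fd \<theta>)" (is "_ \<Longrightarrow> ?lower")
proof -
  let ?V = "spanT \<psi> J"
  let ?W = "orthogonal_comp ?V"
  let ?D = "orth_proj ?W ` sublevel nrm \<tau>"
  let ?S = "\<lambda>t. {x + y | x y. x \<in> ?V \<inter> sublevel fd t \<and> y \<in> ?D}"
  let ?m = "measure (subspace_lebesgue ?V) (?V \<inter> sublevel fd 1)"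
  let ?c = "measure (subspace_lebesgue ?W) (orth_proj ?W ` sublevel nrm 1)"
  have V: "subspace ?V" and W: "subspace ?W"
    by (rule subspace_spanT subspace_orthogonal_comp)+
  have compV: "compact (?V \<inter> sublevel fd t)" for t
    by (intro closed_Int_compact closed_subspace V compact_sublevel fd)
  have compD: "compact ?D"
    by (intro compact_proj_sublevel W nrm)
  have DW: "?D \<subseteq> ?W"
    using orth_proj_in(1)[OF W] by blast
  have compS: "compact (?S t)" for t
    by (intro compact_sums compV compD)
  have mS: "measure lebesgue (?S t)
      = measure (subspace_lebesgue ?V) (?V \<inter> sublevel fd t) * (\<tau> ^ (DIM('a) - K) * ?c)" for t
    using measure_orthogonal_sum[OF V _ compV DW compD]
    by (simp add: measure_subspace_proj_sublevel[OF W nrm \<tau>] dim_orthogonal_comp[OF V] dimJ)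
  have fdD: "fd y \<le> \<delta>J * \<tau>" if "y \<in> ?D" for y
  proof -
    have "fd y \<le> \<delta>J * proj_norm nrm \<psi> J y"
      using that DW by (intro \<delta>J) auto
    also have "\<dots> \<le> \<delta>J * \<tau>"
      using proj_norm_le[OF nrm \<tau> that] \<delta>J(1) by (rule mult_left_mono)
    finally show ?thesis .
  qed
  have lm: "cylT nrm \<psi> J \<tau> \<inter> sublevel fd \<theta> \<in> lmeasurable"
    by (rule lmeasurable_cylT_Int_sublevel[OF nrm fd])
  show ?upper
  proof -
    have "cylT nrm \<psi> J \<tau> \<inter> sublevel fd \<theta> \<subseteq> ?S (\<theta> + \<delta>J * \<tau>)"
    proof
      fix d assume "d \<in> cylT nrm \<psi> J \<tau> \<inter> sublevel fd \<theta>"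
      then obtain x y where d: "d = x + y" "x \<in> ?V" "y \<in> ?D" "fd d \<le> \<theta>"
        unfolding cylT_def sublevel_def by blast
      \<comment> \<open>Dropping the component \<open>y\<close> changes \<open>fd\<close> by at most
        \<open>fd y\<close>, which is bounded on the cross section.\<close>
      have "\<bar>fd d - fd x\<bar> \<le> fd y"
        using is_norm_diff_le[OF fd, of d x] d(1) by simp
      then have "fd x \<le> \<theta> + \<delta>J * \<tau>"
        using d(4) fdD[OF d(3)] by linarith
      then show "d \<in> ?S (\<theta> + \<delta>J * \<tau>)"
        using d unfolding sublevel_def by blast
    qed
    then have "measure lebesgue (cylT nrm \<psi> J \<tau> \<inter> sublevel fd \<theta>) \<le> measure lebesgue (?S (\<theta> + \<delta>J * \<tau>))"
      by (rule measure_mono_fmeasurable[OF _ fmeasurableD lmeasurable_compact]) (fact lm compS)+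
    also have "\<dots> = (\<theta> + \<delta>J * \<tau>) ^ K * ?m * (\<tau> ^ (DIM('a) - K) * ?c)"
      using \<theta> \<delta>J(1) \<tau> by (simp only: mS) (subst measure_subspace_sublevel[OF V fd], auto simp: dimJ intro: add_pos_nonneg)
    finally show ?thesis
      by (simp add: const_C_def mult_ac)
  qed
  show ?lower if "\<theta> \<ge> \<delta>J * \<tau>"
  proof -
    have "?S (\<theta> - \<delta>J * \<tau>) \<subseteq> cylT nrm \<psi> J \<tau> \<inter> sublevel fd \<theta>"
    proof
      fix d assume "d \<in> ?S (\<theta> - \<delta>J * \<tau>)"
      then obtain x y where d: "d = x + y" "x \<in> ?V" "fd x \<le> \<theta> - \<delta>J * \<tau>" "y \<in> ?D"
        unfolding sublevel_def by blast
      have "fd d \<le> fd x + fd y"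
        using fd d(1) by (simp add: is_norm_def)
      then have "fd d \<le> \<theta>"
        using d(3) fdD[OF d(4)] by linarith
      then show "d \<in> cylT nrm \<psi> J \<tau> \<inter> sublevel fd \<theta>"
        using d unfolding cylT_def sublevel_def by blast
    qed
    then have "measure lebesgue (?S (\<theta> - \<delta>J * \<tau>)) \<le> measure lebesgue (cylT nrm \<psi> J \<tau> \<inter> sublevel fd \<theta>)"
      by (rule measure_mono_fmeasurable[OF _ fmeasurableD[OF lmeasurable_compact]]) (fact lm compS)+
    \<comment> \<open>The shrunken radius may be \<open>0\<close>, so the inequality for nonnegative
      radii replaces the exact scaling law used for the upper bound.\<close>
    moreover have "(\<theta> - \<delta>J * \<tau>) ^ K * ?m * (\<tau> ^ (DIM('a) - K) * ?c) \<le> measure lebesgue (?S (\<theta> - \<delta>J * \<tau>))"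
      unfolding mS using measure_subspace_sublevel_ge[OF V fd, of "\<theta> - \<delta>J * \<tau>"] that \<tau>
      by (intro mult_right_mono) (auto simp: dimJ)
    ultimately show ?thesis
      by (simp add: const_C_def mult_ac)
  qed
qed

section \<open>Sparse data as a union of cylinders\<close>

text \<open>Coefficients are attached to indices rather than to vectors, so that a dictionary with
  repeated vectors is handled and the sums match those in \<open>spval\<close>.\<close>

lemma spanT_finite:
  assumes "finite J"
  shows "spanT \<psi> J = range (\<lambda>c. \<Sum>j\<in>J. c j *\<^sub>R \<psi> j)"
proof (rule subset_antisym)
  have "subspace (range (\<lambda>c. \<Sum>j\<in>J. c j *\<^sub>R \<psi> j))"
  proof (rule subspaceI)
    show "0 \<in> range (\<lambda>c. \<Sum>j\<in>J. c j *\<^sub>R \<psi> j)"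
      by (rule range_eqI[of _ _ "\<lambda>_. 0"]) simp
    show "x + y \<in> range (\<lambda>c. \<Sum>j\<in>J. c j *\<^sub>R \<psi> j)"
      if "x \<in> range (\<lambda>c. \<Sum>j\<in>J. c j *\<^sub>R \<psi> j)" "y \<in> range (\<lambda>c. \<Sum>j\<in>J. c j *\<^sub>R \<psi> j)" for x y
      using that by (auto simp: sum.distrib[symmetric] scaleR_add_left[symmetric])
    show "a *\<^sub>R x \<in> range (\<lambda>c. \<Sum>j\<in>J. c j *\<^sub>R \<psi> j)"
      if "x \<in> range (\<lambda>c. \<Sum>j\<in>J. c j *\<^sub>R \<psi> j)" for a x
      using that by (auto simp: scaleR_sum_right)
  qed
  moreover have "\<psi> i \<in> range (\<lambda>c. \<Sum>j\<in>J. c j *\<^sub>R \<psi> j)" if "i \<in> J" for i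
  proof (rule range_eqI)
    have "(\<Sum>j\<in>J. (if j = i then 1 else 0) *\<^sub>R \<psi> j) = (\<Sum>j\<in>J. if j = i then \<psi> j else 0)"
      by (intro sum.cong) auto
    then show "\<psi> i = (\<Sum>j\<in>J. (if j = i then 1 else 0) *\<^sub>R \<psi> j)"
      using that assms by simp
  qed
  ultimately show "spanT \<psi> J \<subseteq> range (\<lambda>c. \<Sum>j\<in>J. c j *\<^sub>R \<psi> j)"
    unfolding spanT_def by (intro span_minimal) auto
  show "range (\<lambda>c. \<Sum>j\<in>J. c j *\<^sub>R \<psi> j) \<subseteq> spanT \<psi> J"
    unfolding spanT_def by (auto intro: span_sum span_scale span_base)
qed

lemma spanT_mono: "J \<subseteq> J' \<Longrightarrow> spanT \<psi> J \<subseteq> spanT \<psi> J'"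
  unfolding spanT_def by (intro span_mono image_mono)

text \<open>As long as the span is a proper subspace, some dictionary vector lies outside it, and
  adding its index raises the dimension by exactly one.\<close>

lemma extend_to_dim:
  fixes \<psi> :: "'i \<Rightarrow> 'a::euclidean_space"
  assumes span: "span (\<psi> ` I) = UNIV" and J: "J \<subseteq> I"
    and K: "dim (spanT \<psi> J) \<le> K" "K \<le> DIM('a)"
  shows "\<exists>J'. J \<subseteq> J' \<and> J' \<subseteq> I \<and> dim (spanT \<psi> J') = K"
  using K
proof (induction rule: dec_induct)
  case base
  then show ?case using J by blast
next
  case (step n)
  then obtain J' where J': "J \<subseteq> J'" "J' \<subseteq> I" "dim (spanT \<psi> J') = n"
    by auto
  have "spanT \<psi> J' \<noteq> UNIV"
    using J'(3) step by auto
  then have "\<not> \<psi> ` I \<subseteq> spanT \<psi> J'"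
    using span span_minimal[of "\<psi> ` I" "spanT \<psi> J'"] subspace_spanT[of \<psi> J'] by auto
  then obtain i where i: "i \<in> I" "\<psi> i \<notin> span (\<psi> ` J')"
    unfolding spanT_def by blast
  have "dim (spanT \<psi> (insert i J')) = Suc n"
    using i(2) J'(3) unfolding spanT_def by (simp add: dim_insert)
  then show ?case
    using i(1) J' by (intro exI[of _ "insert i J'"]) auto
qed

text \<open>The span of \<open>J\<close> is already spanned by as many dictionary elements as its
  dimension, so a point of the cylinder is approximated with at most that many nonzero
  coefficients.\<close>

lemma sparse_data_memI:
  fixes \<psi> :: "'i \<Rightarrow> 'a::euclidean_space"
  assumes nrm: "is_norm nrm" and I: "finite I" and J: "J \<subseteq> I" and d: "d \<in> cylT nrm \<psi> J \<tau>"
  shows "d \<in> sparse_data nrm \<psi> I (dim (spanT \<psi> J)) \<tau>"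
proof -
  obtain B where B: "B \<subseteq> \<psi> ` J" "independent B" "\<psi> ` J \<subseteq> span B" "card B = dim (\<psi> ` J)"
    using basis_exists by blast
  \<comment> \<open>The basis is pulled back to indices on which \<open>\<psi>\<close> is injective,
    so that counting indices agrees with counting basis vectors.\<close>
  obtain J' where J': "J' \<subseteq> J" "inj_on \<psi> J'" "B = \<psi> ` J'"
    using B(1) unfolding subset_image_inj by blast
  have finJ': "finite J'"
    using J J'(1) I by (meson finite_subset)
  have span_eq: "spanT \<psi> J = spanT \<psi> J'"
    unfolding spanT_def J'(3)[symmetric]
    using B(1,3) by (metis span_eq span_superset subset_trans)
  have cardJ': "card J' = dim (spanT \<psi> J)"
    using B(4) J'(2,3) by (simp add: card_image spanT_def)
  obtain x w where xw: "d = x + w" "x \<in> spanT \<psi> J'" "nrm w \<le> \<tau>"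
    using d unfolding cylT_eq_sums sublevel_def span_eq by blast
  obtain c where c: "x = (\<Sum>j\<in>J'. c j *\<^sub>R \<psi> j)"
    using xw(2) unfolding spanT_finite[OF finJ'] by blast
  \<comment> \<open>Extension by zero turns \<open>c\<close> into a competitor in the sparsity
    problem; its support lies in \<open>J'\<close> but may be smaller, since some \<open>c i\<close>
    can vanish.\<close>
  define c' where "c' i = (if i \<in> J' then c i else 0)" for i
  have "(\<Sum>i\<in>I. c' i *\<^sub>R \<psi> i) = (\<Sum>i\<in>J'. c' i *\<^sub>R \<psi> i)"
    using I J J'(1) by (intro sum.mono_neutral_right) (auto simp: c'_def)
  also have "\<dots> = x"
    unfolding c by (intro sum.cong) (auto simp: c'_def)
  finally have "nrm ((\<Sum>i\<in>I. c' i *\<^sub>R \<psi> i) - d) \<le> \<tau>"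
    using xw(1,3) is_norm_minus[OF nrm] by simp
  then have "spval nrm \<psi> I \<tau> d \<le> card {i\<in>I. c' i \<noteq> 0}"
    unfolding spval_def by (intro wellorder_Inf_le1) blast
  also have "\<dots> \<le> card J'"
    by (intro card_mono finJ') (auto simp: c'_def split: if_splits)
  finally show ?thesis
    by (simp add: sparse_data_def cardJ')
qed

text \<open>The witness \<open>J\<close> is the support of a minimiser. A minimiser exists because
  the dictionary represents \<open>d\<close> exactly, so the set of attained cardinalities is
  nonempty and contains its \<open>Inf\<close>.\<close>

lemma sparse_dataE:
  fixes \<psi> :: "'i \<Rightarrow> 'a::euclidean_space"
  assumes nrm: "is_norm nrm" and I: "finite I" and span: "span (\<psi> ` I) = UNIV" and \<tau>: "\<tau> > 0"
    and d: "d \<in> sparse_data nrm \<psi> I K \<tau>"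
  obtains J where "J \<subseteq> I" "dim (spanT \<psi> J) \<le> K" "d \<in> cylT nrm \<psi> J \<tau>"
proof -
  let ?S = "{card {i\<in>I. c i \<noteq> 0} | c. nrm ((\<Sum>i\<in>I. c i *\<^sub>R \<psi> i) - d) \<le> \<tau>}"
  have "d \<in> spanT \<psi> I"
    using span by (simp add: spanT_def)
  then obtain c where "d = (\<Sum>i\<in>I. c i *\<^sub>R \<psi> i)"
    unfolding spanT_finite[OF I] by blast
  moreover have "nrm 0 \<le> \<tau>"
    using \<tau> by (simp add: is_norm_zero[OF nrm])
  ultimately have "nrm ((\<Sum>i\<in>I. c i *\<^sub>R \<psi> i) - d) \<le> \<tau>"
    by simp
  then have "?S \<noteq> {}" by blast
  then have "spval nrm \<psi> I \<tau> d \<in> ?S"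
    unfolding spval_def by (rule Inf_nat_def1)
  then obtain c where c: "spval nrm \<psi> I \<tau> d = card {i\<in>I. c i \<noteq> 0}" "nrm ((\<Sum>i\<in>I. c i *\<^sub>R \<psi> i) - d) \<le> \<tau>"
    by blast
  define J where "J = {i\<in>I. c i \<noteq> 0}"
  have J: "J \<subseteq> I" "finite J"
    using I by (auto simp: J_def)
  have "dim (spanT \<psi> J) \<le> card (\<psi> ` J)"
    unfolding spanT_def dim_span using J(2) by (intro dim_le_card') simp
  also have "\<dots> \<le> card J"
    using J(2) by (rule card_image_le)
  also have "\<dots> \<le> K"
    using d c(1) by (simp add: sparse_data_def J_def)
  finally have dimJ: "dim (spanT \<psi> J) \<le> K" .
  let ?x = "\<Sum>i\<in>I. c i *\<^sub>R \<psi> i"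
  have "?x = (\<Sum>i\<in>J. c i *\<^sub>R \<psi> i)"
    using I by (intro sum.mono_neutral_right) (auto simp: J_def)
  then have "?x \<in> spanT \<psi> J"
    unfolding spanT_finite[OF J(2)] by blast
  moreover have "nrm (d - ?x) \<le> \<tau>"
    using c(2) is_norm_minus[OF nrm, of "?x - d"] by simp
  moreover have "d = ?x + (d - ?x)" by simp
  ultimately have "d \<in> cylT nrm \<psi> J \<tau>"
    unfolding cylT_eq_sums sublevel_def by blast
  with J(1) dimJ that show ?thesis by blast
qed

lemma span_representativesD:
  fixes \<psi> :: "'i \<Rightarrow> 'a::euclidean_space"
  assumes "span_representatives \<psi> I \<J>" "K \<le> DIM('a)"
  shows "J \<in> \<J> K \<Longrightarrow> J \<subseteq> I" "J \<in> \<J> K \<Longrightarrow> dim (spanT \<psi> J) = K"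
    and "J \<subseteq> I \<Longrightarrow> dim (spanT \<psi> J) = K \<Longrightarrow> \<exists>J'\<in>\<J> K. spanT \<psi> J = spanT \<psi> J'"
    and "inj_on (spanT \<psi>) (\<J> K)" "\<J> 0 = {{}}"
  using assms by (simp_all add: span_representatives_def)

text \<open>The support of a minimiser may span fewer than \<open>K\<close> dimensions. It is
  enlarged to an index set of dimension \<open>K\<close> and exchanged for the representative of
  that span; the cylinder only grows.\<close>

lemma sparse_data_eq_Union:
  fixes \<psi> :: "'i \<Rightarrow> 'a::euclidean_space"
  assumes nrm: "is_norm nrm" and I: "finite I" "span (\<psi> ` I) = UNIV"
    and rep: "span_representatives \<psi> I \<J>" and K: "K \<le> DIM('a)" and \<tau>: "\<tau> > 0"
  shows "sparse_data nrm \<psi> I K \<tau> = (\<Union>J\<in>\<J> K. cylT nrm \<psi> J \<tau>)"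
proof (intro subset_antisym subsetI)
  fix d assume "d \<in> sparse_data nrm \<psi> I K \<tau>"
  then obtain J where J: "J \<subseteq> I" "dim (spanT \<psi> J) \<le> K" "d \<in> cylT nrm \<psi> J \<tau>"
    by (rule sparse_dataE[OF nrm I \<tau>])
  obtain J1 where J1: "J \<subseteq> J1" "J1 \<subseteq> I" "dim (spanT \<psi> J1) = K"
    using extend_to_dim[OF I(2) J(1,2) K] by blast
  obtain J2 where J2: "J2 \<in> \<J> K" "spanT \<psi> J1 = spanT \<psi> J2"
    using span_representativesD(3)[OF rep K J1(2,3)] by blast
  have "cylT nrm \<psi> J \<tau> \<subseteq> cylT nrm \<psi> J2 \<tau>"
    using spanT_mono[OF J1(1), of \<psi>] unfolding cylT_eq_sums J2(2) by blast
  then show "d \<in> (\<Union>J\<in>\<J> K. cylT nrm \<psi> J \<tau>)"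
    using J(3) J2(1) by blast
next
  fix d assume "d \<in> (\<Union>J\<in>\<J> K. cylT nrm \<psi> J \<tau>)"
  then obtain J where "J \<in> \<J> K" "d \<in> cylT nrm \<psi> J \<tau>"
    by blast
  then show "d \<in> sparse_data nrm \<psi> I K \<tau>"
    using sparse_data_memI[OF nrm I(1), of J] span_representativesD(1,2)[OF rep K] by metis
qed

section \<open>Measure of the sparse data\<close>

text \<open>Bonferroni's inequality over ordered pairs: each overlap is subtracted twice, in
  agreement with the ordered pairs in \<open>pairs_H\<close>. In the induction, a new set loses at
  most the sum of its overlaps with the earlier ones.\<close>

lemma measure_UNION_ge_pairs:
  assumes "finite S" "\<And>i. i \<in> S \<Longrightarrow> F i \<in> fmeasurable M"
  shows "(\<Sum>i\<in>S. measure M (F i)) - (\<Sum>(i, j)\<in>{(i, j). i \<in> S \<and> j \<in> S \<and> i \<noteq> j}. measure M (F i \<inter> F j))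
    \<le> measure M (\<Union>i\<in>S. F i)"
  using assms
proof (induction rule: finite_induct)
  case empty
  then show ?case by simp
next
  case (insert a S)
  let ?P = "\<lambda>S. {(i, j). i \<in> S \<and> j \<in> S \<and> i \<noteq> j}"
  let ?U = "\<Union>i\<in>S. F i"
  let ?m = "\<lambda>(i, j). measure M (F i \<inter> F j)"
  have U: "?U \<in> fmeasurable M"
    using insert.hyps(1) insert.prems by (intro fmeasurable.finite_UN) simp_all
  have "measure M (F a \<inter> ?U) = measure M (\<Union>j\<in>S. F a \<inter> F j)"
    by simp
  also have "\<dots> \<le> (\<Sum>j\<in>S. measure M (F a \<inter> F j))"
    using insert by (intro measure_UNION_le) (auto intro: fmeasurableD)
  finally have *: "measure M (F a \<inter> ?U) \<le> (\<Sum>j\<in>S. measure M (F a \<inter> F j))" .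
  have finP: "finite (?P T)" if "finite T" for T :: "'a set"
    by (rule finite_subset[of _ "T \<times> T"]) (use that in auto)
  \<comment> \<open>Only the new pairs \<open>(a, j)\<close> are used; the reversed pairs
    \<open>(j, a)\<close> contribute nonnegative terms, which accounts for the inequality that
    follows.\<close>
  have "(\<Sum>p\<in>?P S. ?m p) + (\<Sum>j\<in>S. measure M (F a \<inter> F j)) = (\<Sum>p\<in>?P S \<union> Pair a ` S. ?m p)"
    using insert.hyps finP by (subst sum.union_disjoint) (auto simp: sum.reindex inj_on_def)
  also have "\<dots> \<le> (\<Sum>p\<in>?P (insert a S). ?m p)"
    using insert.hyps(2) by (intro sum_mono2 finP finite.insertI insert.hyps(1)) auto
  finally have "(\<Sum>p\<in>?P S. ?m p) + (\<Sum>j\<in>S. measure M (F a \<inter> F j)) \<le> (\<Sum>p\<in>?P (insert a S). ?m p)" .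
  moreover have "measure M (\<Union>i\<in>insert a S. F i) = measure M (F a) + measure M ?U - measure M (F a \<inter> ?U)"
    using measure_Un3[OF _ U, of "F a"] insert.prems by simp
  moreover have "(\<Sum>i\<in>S. measure M (F i)) - (\<Sum>p\<in>?P S. ?m p) \<le> measure M ?U"
    using insert by simp
  ultimately show ?case
    using * insert.hyps by simp
qed

text \<open>\<open>Delta\<close> is a running maximum. The first bound makes the radius
  \<open>\<theta> - hat_delta \<J> \<delta> K * \<tau>\<close> nonnegative, the second makes
  \<open>\<theta>\<close> positive, and the third admits the hypothesis on pairwise
  intersections.\<close>

lemma Delta_ge:
  fixes \<psi> :: "'i \<Rightarrow> 'a::euclidean_space"
  shows "hat_delta \<J> \<delta> K \<le> Delta \<psi> \<J> \<delta> \<delta>' K"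
    and "hat_delta \<J> \<delta> 0 \<le> Delta \<psi> \<J> \<delta> \<delta>' K"
    and "0 < K \<Longrightarrow> K < DIM('a) \<Longrightarrow> k_min DIM('a) K \<le> k \<Longrightarrow> k \<le> K - 1
      \<Longrightarrow> hat_delta' \<psi> \<J> \<delta>' K k \<le> Delta \<psi> \<J> \<delta> \<delta>' K"
proof -
  show "hat_delta \<J> \<delta> K \<le> Delta \<psi> \<J> \<delta> \<delta>' K"
    by (cases K) auto
  show "hat_delta \<J> \<delta> 0 \<le> Delta \<psi> \<J> \<delta> \<delta>' K"
  proof (induction K)
    case (Suc K)
    have "Delta \<psi> \<J> \<delta> \<delta>' K \<le> Delta \<psi> \<J> \<delta> \<delta>' (Suc K)"
      by simp
    with Suc show ?case by linarith
  qed simp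
  assume k: "0 < K" "K < DIM('a)" "k_min DIM('a) K \<le> k" "k \<le> K - 1"
  then obtain L where L: "K = Suc L" by (cases K) auto
  have "hat_delta' \<psi> \<J> \<delta>' K k \<le> Max (hat_delta' \<psi> \<J> \<delta>' K ` {k_min DIM('a) K..L})"
    using k L by (intro Max_ge) auto
  also have "\<dots> \<le> Delta \<psi> \<J> \<delta> \<delta>' K"
    using k(2) unfolding L Delta.simps if_P[OF k(2)[unfolded L]] by (intro Max_ge) simp_all
  finally show "hat_delta' \<psi> \<J> \<delta>' K k \<le> Delta \<psi> \<J> \<delta> \<delta>' K" .
qed

lemma Delta_le:
  fixes \<psi> :: "'i \<Rightarrow> 'a::euclidean_space"
  assumes "K \<le> DIM('a)"
    and "\<And>L. L \<le> DIM('a) \<Longrightarrow> hat_delta \<J> \<delta> L \<le> b"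
    and "\<And>L k. L \<le> DIM('a) \<Longrightarrow> k < L \<Longrightarrow> hat_delta' \<psi> \<J> \<delta>' L k \<le> b"
  shows "Delta \<psi> \<J> \<delta> \<delta>' K \<le> b"
  using assms(1)
proof (induction K)
  case 0
  then show ?case using assms(2) by simp
next
  case (Suc K)
  \<comment> \<open>Strictness of \<open>Suc K < DIM('a)\<close> makes the interval of indices
    nonempty, as the characterisation of \<open>Max\<close> requires.\<close>
  have "Max (hat_delta' \<psi> \<J> \<delta>' (Suc K) ` {k_min DIM('a) (Suc K)..K}) \<le> b" if "Suc K < DIM('a)"
    using assms(3)[of "Suc K"] that by (subst Max_le_iff) (auto simp: k_min_def)
  then show ?case
    using Suc assms(2)[of "Suc K"] unfolding Delta.simps by auto
qed

text \<open>The data over an arbitrary Euclidean space, with \<open>DIM('a)\<close> for the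
  dimension. The parameter \<open>b\<close> stands for the product
  \<open>\<delta>1 * \<delta>2\<close>.\<close>

locale sparsity_setting =
  fixes nrm fd :: "'a::euclidean_space \<Rightarrow> real"
    and \<psi> :: "'i \<Rightarrow> 'a" and I :: "'i set"
    and b \<delta>2 :: real
    and \<delta> :: "'i set \<Rightarrow> real" and \<delta>' :: "'i set \<Rightarrow> 'i set \<Rightarrow> real"
    and \<J> :: "nat \<Rightarrow> 'i set set"
  assumes nrm: "is_norm nrm" and fd: "is_norm fd"
    and I: "finite I" "span (\<psi> ` I) = UNIV"
    and delta: "\<And>J. J \<subseteq> I \<Longrightarrow> 0 \<le> \<delta> J \<and> \<delta> J \<le> b"
      "\<And>J u. J \<subseteq> I \<Longrightarrow> u \<in> orthogonal_comp (spanT \<psi> J) \<Longrightarrow> fd u \<le> \<delta> J * proj_norm nrm \<psi> J u"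
    and representatives: "span_representatives \<psi> I \<J>"
    and delta': "\<And>L k J1 J2. L \<le> DIM('a) \<Longrightarrow> k < L \<Longrightarrow> (J1, J2) \<in> pairs_H \<psi> \<J> L k \<Longrightarrow>
        0 \<le> \<delta>' J1 J2 \<and> \<delta>' J1 J2 \<le> 3 * b"
      "\<And>L k J1 J2 \<tau> \<theta>. L \<le> DIM('a) \<Longrightarrow> k < L \<Longrightarrow> (J1, J2) \<in> pairs_H \<psi> \<J> L k \<Longrightarrow>
        \<tau> > 0 \<Longrightarrow> \<theta> > 0 \<Longrightarrow> \<theta> \<ge> \<delta>' J1 J2 * \<tau> \<Longrightarrow>
        measure lebesgue (cylT nrm \<psi> J1 \<tau> \<inter> cylT nrm \<psi> J2 \<tau> \<inter> sublevel fd \<theta>)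
          \<le> const_Q \<delta>2 fd \<psi> J1 J2 * \<tau> ^ (DIM('a) - k) * (\<theta> + \<delta>' J1 J2 * \<tau>) ^ k"
begin

section \<open>Well-definedness and size of the constants\<close>

lemma finite_representatives: "K \<le> DIM('a) \<Longrightarrow> finite (\<J> K)"
  using span_representativesD(1)[OF representatives]
  by (intro finite_subset[OF _ finite_Pow_iff[THEN iffD2, OF I(1)]]) auto

text \<open>This makes the \<open>Max\<close> in \<open>hat_delta\<close> a maximum over a nonempty
  set. The empty index set has dimension 0 and extends to dimension \<open>K\<close>.\<close>

lemma representatives_nonempty:
  assumes "K \<le> DIM('a)"
  shows "\<J> K \<noteq> {}"
proof -
  have "dim (spanT \<psi> {}) \<le> K"
    by (simp add: spanT_def)
  then obtain J where "J \<subseteq> I" "dim (spanT \<psi> J) = K"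
    using extend_to_dim[OF I(2), of "{}"] assms by blast
  then show ?thesis
    using span_representativesD(3)[OF representatives assms] by blast
qed

lemma finite_pairs_H: "K \<le> DIM('a) \<Longrightarrow> finite (pairs_H \<psi> \<J> K k)"
  by (rule finite_subset[of _ "\<J> K \<times> \<J> K"]) (auto simp: pairs_H_def finite_representatives)

lemma delta_le_hat_delta: "K \<le> DIM('a) \<Longrightarrow> J \<in> \<J> K \<Longrightarrow> \<delta> J \<le> hat_delta \<J> \<delta> K"
  unfolding hat_delta_def using finite_representatives by simp

lemma hat_delta_bounds:
  assumes K: "K \<le> DIM('a)"
  shows "0 \<le> hat_delta \<J> \<delta> K" "hat_delta \<J> \<delta> K \<le> b"
proof -
  have "hat_delta \<J> \<delta> K \<in> \<delta> ` \<J> K"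
    unfolding hat_delta_def using finite_representatives[OF K] representatives_nonempty[OF K]
    by (intro Max_in) auto
  then obtain J where J: "J \<in> \<J> K" "hat_delta \<J> \<delta> K = \<delta> J"
    by blast
  have "J \<subseteq> I"
    using span_representativesD(1)[OF representatives K J(1)] .
  then show "0 \<le> hat_delta \<J> \<delta> K" "hat_delta \<J> \<delta> K \<le> b"
    using delta(1) J(2) by simp_all
qed

lemma b_nonneg: "0 \<le> b"
  using delta(1)[of "{}"] by simp

lemma hat_delta'_bounds:
  assumes K: "K \<le> DIM('a)" and k: "k < K"
  shows "0 \<le> hat_delta' \<psi> \<J> \<delta>' K k" "hat_delta' \<psi> \<J> \<delta>' K k \<le> 3 * b"
  unfolding hat_delta'_def using finite_pairs_H[OF K] b_nonneg delta'(1)[OF K k]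
  by (simp, subst Max_le_iff) auto

lemma delta'_le_hat_delta':
  assumes "K \<le> DIM('a)" "(J1, J2) \<in> pairs_H \<psi> \<J> K k"
  shows "\<delta>' J1 J2 \<le> hat_delta' \<psi> \<J> \<delta>' K k"
  unfolding hat_delta'_def using finite_pairs_H[OF assms(1)] assms(2)
  by (intro Max_ge) force+

lemma Delta_bounds:
  assumes K: "K \<le> DIM('a)"
  shows "0 \<le> Delta \<psi> \<J> \<delta> \<delta>' K" "Delta \<psi> \<J> \<delta> \<delta>' K \<le> 3 * b"
proof -
  show "0 \<le> Delta \<psi> \<J> \<delta> \<delta>' K"
    using hat_delta_bounds(1)[OF K] Delta_ge(1)[of \<J> \<delta> K \<psi> \<delta>'] by linarith
  show "Delta \<psi> \<J> \<delta> \<delta>' K \<le> 3 * b"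
  proof (rule Delta_le[OF K])
    show "hat_delta \<J> \<delta> L \<le> 3 * b" if "L \<le> DIM('a)" for L
      using hat_delta_bounds(2)[OF that] b_nonneg by linarith
    show "hat_delta' \<psi> \<J> \<delta>' L k \<le> 3 * b" if "L \<le> DIM('a)" "k < L" for L k
      using hat_delta'_bounds(2)[OF that] .
  qed
qed

text \<open>The span of the empty set is \<open>{0}\<close>, whose complement is the whole space.
  The defining inequality of \<open>\<delta> {}\<close> at a basis vector has a positive left side,
  which rules out \<open>\<delta> {} = 0\<close>.\<close>

lemma hat_delta_0_pos: "0 < hat_delta \<J> \<delta> 0"
proof -
  obtain e :: 'a where e: "e \<in> Basis"
    using nonempty_Basis by blast
  then have "fd e > 0"
    using fd nonzero_Basis unfolding is_norm_def by (metis less_eq_real_def)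
  moreover have "fd e \<le> \<delta> {} * proj_norm nrm \<psi> {} e"
    by (intro delta(2)) (simp_all add: spanT_def)
  ultimately have "\<delta> {} \<noteq> 0" by auto
  then have "\<delta> {} > 0"
    using delta(1)[of "{}"] by simp
  moreover have "\<J> 0 = {{}}"
    using span_representativesD(5)[OF representatives] by blast
  ultimately show ?thesis
    by (simp add: hat_delta_def)
qed

text \<open>An intersection of full dimension \<open>K\<close> would equal both spans, against
  injectivity on representatives. The lower bound is the dimension formula, as the sum of the two
  spans has dimension at most \<open>DIM('a)\<close>.\<close>

lemma dim_Int_representatives:
  assumes K: "K \<le> DIM('a)" and J: "J1 \<in> \<J> K" "J2 \<in> \<J> K" "J1 \<noteq> J2"
  shows "K < DIM('a)" "k_min DIM('a) K \<le> dim (spanT \<psi> J1 \<inter> spanT \<psi> J2)"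
    and "dim (spanT \<psi> J1 \<inter> spanT \<psi> J2) < K"
proof -
  let ?V = "spanT \<psi> J1" and ?W = "spanT \<psi> J2"
  have V: "subspace ?V" and W: "subspace ?W"
    by (rule subspace_spanT)+
  have dims: "dim ?V = K" "dim ?W = K"
    using span_representativesD(2)[OF representatives K] J(1,2) by auto
  have ne: "?V \<noteq> ?W"
    using span_representativesD(4)[OF representatives K] J by (auto dest: inj_onD)
  have sub: "subspace (?V \<inter> ?W)"
    using V W by (rule subspace_inter)
  show lt: "dim (?V \<inter> ?W) < K"
  proof (rule ccontr)
    assume "\<not> dim (?V \<inter> ?W) < K"
    then have "?V \<inter> ?W = ?V" "?V \<inter> ?W = ?W"
      using dims by (intro subspace_dim_equal sub V W; simp)+
    with ne show False by simp
  qed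
  have "dim {x + y | x y. x \<in> ?V \<and> y \<in> ?W} + dim (?V \<inter> ?W) = 2 * K"
    using dim_sums_Int[OF V W] dims by simp
  moreover have "dim {x + y | x y. x \<in> ?V \<and> y \<in> ?W} \<le> DIM('a)"
    by (rule dim_subset_UNIV)
  ultimately have "2 * K \<le> DIM('a) + dim (?V \<inter> ?W)"
    by linarith
  then show "k_min DIM('a) K \<le> dim (?V \<inter> ?W)" "K < DIM('a)"
    using lt by (auto simp: k_min_def)
qed

section \<open>The error term and the two-sided estimate\<close>

lemma const_C_nonneg: "0 \<le> const_C nrm fd \<psi> J"
  by (simp add: const_C_def)

lemma const_Q_nonneg: "0 \<le> const_Q \<delta>2 fd \<psi> J1 J2"
  by (simp add: const_Q_def Let_def)

text \<open>Distinct pairs are grouped by the dimension \<open>k\<close> of the intersection of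
  their spans. Within a group, each \<open>\<delta>'\<close> is replaced by the common
  \<open>hat_delta'\<close>, and pulling out a power of \<open>\<theta>\<close> gives the summand of
  \<open>eps0\<close>.\<close>

lemma intersections_le_eps0:
  assumes K: "K \<le> DIM('a)" and \<tau>: "\<tau> > 0" and \<theta>: "\<theta> > 0" "\<theta> \<ge> \<tau> * Delta \<psi> \<J> \<delta> \<delta>' K"
  shows "(\<Sum>(J1, J2)\<in>{(J1, J2). J1 \<in> \<J> K \<and> J2 \<in> \<J> K \<and> J1 \<noteq> J2}.
      measure lebesgue ((cylT nrm \<psi> J1 \<tau> \<inter> sublevel fd \<theta>) \<inter> (cylT nrm \<psi> J2 \<tau> \<inter> sublevel fd \<theta>)))
    \<le> \<theta> ^ DIM('a) * eps0 \<delta>2 fd \<psi> \<J> \<delta>' K \<tau> \<theta>"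
proof (cases "0 < K \<and> K < DIM('a)")
  case False
  then have no_pairs: "{(J1, J2). J1 \<in> \<J> K \<and> J2 \<in> \<J> K \<and> J1 \<noteq> J2} = {}"
    using dim_Int_representatives[OF K] by fastforce
  have eps0: "eps0 \<delta>2 fd \<psi> \<J> \<delta>' K \<tau> \<theta> = 0"
    using False unfolding eps0_def by (rule if_not_P)
  show ?thesis
    unfolding no_pairs eps0 by simp
next
  case True
  let ?N = "DIM('a)"
  let ?P = "{(J1, J2). J1 \<in> \<J> K \<and> J2 \<in> \<J> K \<and> J1 \<noteq> J2}"
  let ?dim = "\<lambda>(J1, J2). dim (spanT \<psi> J1 \<inter> spanT \<psi> J2)"
  let ?T = "{k_min ?N K..K - 1}"
  let ?m = "\<lambda>(J1, J2). measure lebesgue ((cylT nrm \<psi> J1 \<tau> \<inter> sublevel fd \<theta>) \<inter> (cylT nrm \<psi> J2 \<tau> \<inter> sublevel fd \<theta>))"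
  have finP: "finite ?P"
    by (rule finite_subset[of _ "\<J> K \<times> \<J> K"]) (use finite_representatives[OF K] in auto)
  have P_dim: "?dim ` ?P \<subseteq> ?T"
    using dim_Int_representatives[OF K] by fastforce
  \<comment> \<open>\<open>pairs_H\<close> does not demand distinct members, but
    \<open>k < K\<close> excludes the diagonal: a span meets itself in dimension
    \<open>K\<close>.\<close>
  have P_eq: "{p \<in> ?P. ?dim p = k} = pairs_H \<psi> \<J> K k" if "k \<in> ?T" for k
  proof -
    have "k < K" using that True by auto
    then have "J1 \<noteq> J2" if "(J1, J2) \<in> pairs_H \<psi> \<J> K k" for J1 J2
      using that span_representativesD(2)[OF representatives K] by (auto simp: pairs_H_def)
    then show ?thesis by (auto simp: pairs_H_def)
  qed
  have "(\<Sum>p\<in>?P. ?m p) = (\<Sum>k\<in>?T. \<Sum>p\<in>{p. p \<in> ?P \<and> ?dim p = k}. ?m p)"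
    by (rule sum.group[OF finP _ P_dim, symmetric]) simp
  also have "\<dots> = (\<Sum>k\<in>?T. \<Sum>p\<in>pairs_H \<psi> \<J> K k. ?m p)"
    by (intro sum.cong refl P_eq)
  also have "\<dots> \<le> (\<Sum>k\<in>?T. \<theta> ^ ?N * (bar_Q \<delta>2 fd \<psi> \<J> K k * (\<tau> / \<theta>) ^ (?N - k)
      * (1 + hat_delta' \<psi> \<J> \<delta>' K k * (\<tau> / \<theta>)) ^ k))"
  proof (rule sum_mono)
    fix k assume k: "k \<in> ?T"
    let ?h = "hat_delta' \<psi> \<J> \<delta>' K k"
    have kK: "k < K" using k True by auto
    have "?m p \<le> (case p of (J1, J2) \<Rightarrow> const_Q \<delta>2 fd \<psi> J1 J2) * (\<tau> ^ (?N - k) * (\<theta> + ?h * \<tau>) ^ k)"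
      if p: "p \<in> pairs_H \<psi> \<J> K k" for p
    proof -
      obtain J1 J2 where J: "p = (J1, J2)" by fastforce
      have d': "0 \<le> \<delta>' J1 J2" "\<delta>' J1 J2 \<le> ?h"
        using delta'(1)[OF K kK] delta'_le_hat_delta'[OF K] p J by auto
      have "\<delta>' J1 J2 \<le> Delta \<psi> \<J> \<delta> \<delta>' K"
        using d'(2) Delta_ge(3)[of K k \<psi> \<J> \<delta>' \<delta>] True k by auto
      then have "\<delta>' J1 J2 * \<tau> \<le> \<tau> * Delta \<psi> \<J> \<delta> \<delta>' K"
        using \<tau> by simp
      then have "\<delta>' J1 J2 * \<tau> \<le> \<theta>"
        using \<theta>(2) by linarith
      then have "measure lebesgue (cylT nrm \<psi> J1 \<tau> \<inter> cylT nrm \<psi> J2 \<tau> \<inter> sublevel fd \<theta>)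
          \<le> const_Q \<delta>2 fd \<psi> J1 J2 * \<tau> ^ (?N - k) * (\<theta> + \<delta>' J1 J2 * \<tau>) ^ k"
        using p J by (intro delta'(2)[OF K kK _ \<tau> \<theta>(1)]) auto
      also have "\<dots> \<le> const_Q \<delta>2 fd \<psi> J1 J2 * \<tau> ^ (?N - k) * (\<theta> + ?h * \<tau>) ^ k"
        using d' \<tau> \<theta>(1) const_Q_nonneg by (intro mult_left_mono power_mono add_left_mono mult_right_mono) auto
      finally show ?thesis
        by (simp add: J mult.assoc Int_ac)
    qed
    then have "(\<Sum>p\<in>pairs_H \<psi> \<J> K k. ?m p)
        \<le> (\<Sum>p\<in>pairs_H \<psi> \<J> K k. (case p of (J1, J2) \<Rightarrow> const_Q \<delta>2 fd \<psi> J1 J2) * (\<tau> ^ (?N - k) * (\<theta> + ?h * \<tau>) ^ k))"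
      by (rule sum_mono)
    also have "\<dots> = bar_Q \<delta>2 fd \<psi> \<J> K k * (\<tau> ^ (?N - k) * (\<theta> + ?h * \<tau>) ^ k)"
      by (simp only: bar_Q_def sum_distrib_right)
    \<comment> \<open>The total degree is \<open>?N\<close>, so \<open>\<theta> ^ ?N\<close> factors
      out and leaves an expression in the ratio \<open>\<tau> / \<theta>\<close>.\<close>
    also have "\<tau> ^ (?N - k) * (\<theta> + ?h * \<tau>) ^ k = \<theta> ^ ?N * ((\<tau> / \<theta>) ^ (?N - k) * (1 + ?h * (\<tau> / \<theta>)) ^ k)"
    proof -
      have "\<theta> ^ ?N = \<theta> ^ (?N - k) * \<theta> ^ k"
        using kK K by (simp add: power_add[symmetric])
      moreover have "\<tau> ^ (?N - k) = \<theta> ^ (?N - k) * (\<tau> / \<theta>) ^ (?N - k)"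
        using \<theta>(1) by (simp add: power_divide)
      moreover have "\<theta> + ?h * \<tau> = \<theta> * (1 + ?h * (\<tau> / \<theta>))"
        using \<theta>(1) by (simp add: field_simps)
      then have "(\<theta> + ?h * \<tau>) ^ k = \<theta> ^ k * (1 + ?h * (\<tau> / \<theta>)) ^ k"
        by (simp only: power_mult_distrib)
      ultimately show ?thesis
        by (simp only: mult_ac)
    qed
    finally show "(\<Sum>p\<in>pairs_H \<psi> \<J> K k. ?m p) \<le> \<theta> ^ ?N * (bar_Q \<delta>2 fd \<psi> \<J> K k * (\<tau> / \<theta>) ^ (?N - k)
        * (1 + ?h * (\<tau> / \<theta>)) ^ k)"
      by (simp only: mult_ac)
  qed
  also have "\<dots> = \<theta> ^ ?N * eps0 \<delta>2 fd \<psi> \<J> \<delta>' K \<tau> \<theta>"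
    using True by (simp add: eps0_def sum_distrib_left)
  finally show ?thesis .
qed

lemma sparse_data_measure_bounds:
  assumes K: "K \<le> DIM('a)" and \<tau>: "\<tau> > 0" and \<theta>: "\<theta> \<ge> \<tau> * Delta \<psi> \<J> \<delta> \<delta>' K"
  shows "bar_C nrm fd \<psi> \<J> K * \<tau> ^ (DIM('a) - K) * (\<theta> - hat_delta \<J> \<delta> K * \<tau>) ^ K
          - \<theta> ^ DIM('a) * eps0 \<delta>2 fd \<psi> \<J> \<delta>' K \<tau> \<theta>
        \<le> measure lebesgue (sparse_data nrm \<psi> I K \<tau> \<inter> sublevel fd \<theta>)" (is ?lower)
    and "measure lebesgue (sparse_data nrm \<psi> I K \<tau> \<inter> sublevel fd \<theta>)
        \<le> bar_C nrm fd \<psi> \<J> K * \<tau> ^ (DIM('a) - K) * (\<theta> + hat_delta \<J> \<delta> K * \<tau>) ^ K" (is ?upper)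
proof -
  let ?N = "DIM('a)" and ?h = "hat_delta \<J> \<delta> K"
  let ?F = "\<lambda>J. cylT nrm \<psi> J \<tau> \<inter> sublevel fd \<theta>"
  have "0 < \<tau> * Delta \<psi> \<J> \<delta> \<delta>' K"
    using \<tau> hat_delta_0_pos Delta_ge(2)[of \<J> \<delta> \<psi> \<delta>' K] by (intro mult_pos_pos) auto
  then have \<theta>_pos: "\<theta> > 0"
    using \<theta> by linarith
  have "?h * \<tau> \<le> \<tau> * Delta \<psi> \<J> \<delta> \<delta>' K"
    using \<tau> Delta_ge(1)[of \<J> \<delta> K \<psi> \<delta>'] by simp
  then have h\<theta>: "?h * \<tau> \<le> \<theta>"
    using \<theta> by linarith
  have lm: "?F J \<in> lmeasurable" for J
    by (rule lmeasurable_cylT_Int_sublevel[OF nrm fd])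
  have fin: "finite (\<J> K)"
    by (rule finite_representatives[OF K])
  have U: "sparse_data nrm \<psi> I K \<tau> \<inter> sublevel fd \<theta> = (\<Union>J\<in>\<J> K. ?F J)"
    using sparse_data_eq_Union[OF nrm I representatives K \<tau>] by auto
  have J: "J \<subseteq> I" "dim (spanT \<psi> J) = K" "0 \<le> \<delta> J" "\<delta> J * \<tau> \<le> ?h * \<tau>" if "J \<in> \<J> K" for J
    using span_representativesD(1,2)[OF representatives K that] delta(1) delta_le_hat_delta[OF K that] \<tau>
    by auto
  have bounds: "measure lebesgue (?F J) \<le> const_C nrm fd \<psi> J * \<tau> ^ (?N - K) * (\<theta> + \<delta> J * \<tau>) ^ K"
    "\<theta> \<ge> \<delta> J * \<tau> \<Longrightarrow> const_C nrm fd \<psi> J * \<tau> ^ (?N - K) * (\<theta> - \<delta> J * \<tau>) ^ K \<le> measure lebesgue (?F J)"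
    if "J \<in> \<J> K" for J
    using cylinder_measure_bounds[OF nrm fd J(3)[OF that] delta(2)[OF J(1)[OF that]] J(2)[OF that] \<tau> \<theta>_pos]
    by auto
  have "measure lebesgue (\<Union>J\<in>\<J> K. ?F J) \<le> (\<Sum>J\<in>\<J> K. measure lebesgue (?F J))"
    using lm by (intro measure_UNION_le fin fmeasurableD)
  also have "\<dots> \<le> (\<Sum>J\<in>\<J> K. const_C nrm fd \<psi> J * \<tau> ^ (?N - K) * (\<theta> + ?h * \<tau>) ^ K)"
  proof (rule sum_mono)
    fix J' assume J': "J' \<in> \<J> K"
    have "(\<theta> + \<delta> J' * \<tau>) ^ K \<le> (\<theta> + ?h * \<tau>) ^ K"
      using J[OF J'] \<tau> \<theta>_pos by (intro power_mono) auto
    then have "const_C nrm fd \<psi> J' * \<tau> ^ (?N - K) * (\<theta> + \<delta> J' * \<tau>) ^ K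
        \<le> const_C nrm fd \<psi> J' * \<tau> ^ (?N - K) * (\<theta> + ?h * \<tau>) ^ K"
      using const_C_nonneg \<tau> by (intro mult_left_mono) auto
    with bounds(1)[OF J'] show "measure lebesgue (?F J') \<le> const_C nrm fd \<psi> J' * \<tau> ^ (?N - K) * (\<theta> + ?h * \<tau>) ^ K"
      by linarith
  qed
  finally show ?upper
    by (simp only: U bar_C_def sum_distrib_right)
  have "(\<Sum>J\<in>\<J> K. const_C nrm fd \<psi> J * \<tau> ^ (?N - K) * (\<theta> - ?h * \<tau>) ^ K) \<le> (\<Sum>J\<in>\<J> K. measure lebesgue (?F J))"
  proof (rule sum_mono)
    fix J' assume J': "J' \<in> \<J> K"
    \<comment> \<open>Monotonicity of the power needs a nonnegative base; this is
      \<open>h\<theta>\<close>, which comes from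
      \<open>\<theta> \<ge> \<tau> * Delta\<close>.\<close>
    have "(\<theta> - ?h * \<tau>) ^ K \<le> (\<theta> - \<delta> J' * \<tau>) ^ K"
      using J[OF J'] h\<theta> by (intro power_mono) auto
    then have "const_C nrm fd \<psi> J' * \<tau> ^ (?N - K) * (\<theta> - ?h * \<tau>) ^ K
        \<le> const_C nrm fd \<psi> J' * \<tau> ^ (?N - K) * (\<theta> - \<delta> J' * \<tau>) ^ K"
      using const_C_nonneg \<tau> by (intro mult_left_mono) auto
    with bounds(2)[OF J'] J(4)[OF J'] h\<theta>
    show "const_C nrm fd \<psi> J' * \<tau> ^ (?N - K) * (\<theta> - ?h * \<tau>) ^ K \<le> measure lebesgue (?F J')"
      by linarith
  qed
  moreover note measure_UNION_ge_pairs[OF fin lm, of "\<lambda>J. J"] intersections_le_eps0[OF K \<tau> \<theta>_pos \<theta>]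
  ultimately show ?lower
    unfolding U bar_C_def sum_distrib_right by linarith
qed

end

theorem theorem2:
  fixes nrm fd :: "real ^ 'n \<Rightarrow> real"
    and \<psi> :: "'i \<Rightarrow> real ^ 'n" and I :: "'i set"
    and \<delta>1 \<delta>2 :: real
    and \<delta> :: "'i set \<Rightarrow> real" and \<delta>' :: "'i set \<Rightarrow> 'i set \<Rightarrow> real"
    and \<J> :: "nat \<Rightarrow> 'i set set"
    and K :: nat
  assumes norms: "is_norm nrm" "is_norm fd"
    and dictionary: "finite I" "span (\<psi> ` I) = UNIV"
    and delta1: "\<delta>1 > 0" "\<And>w. fd w \<le> \<delta>1 * norm w"
    and delta2: "\<delta>2 > 0" "\<And>w. norm w \<le> \<delta>2 * nrm w"
    and delta: "\<And>J. J \<subseteq> I \<Longrightarrow> 0 \<le> \<delta> J \<and> \<delta> J \<le> \<delta>1 * \<delta>2"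
      "\<And>J u. J \<subseteq> I \<Longrightarrow> u \<in> orthogonal_comp (spanT \<psi> J) \<Longrightarrow> fd u \<le> \<delta> J * proj_norm nrm \<psi> J u"
    and representatives: "span_representatives \<psi> I \<J>"
    and delta': "\<And>L k J1 J2. L \<le> CARD('n) \<Longrightarrow> k < L \<Longrightarrow> (J1, J2) \<in> pairs_H \<psi> \<J> L k \<Longrightarrow>
        0 \<le> \<delta>' J1 J2 \<and> \<delta>' J1 J2 \<le> 3 * (\<delta>1 * \<delta>2)"
      "\<And>L k J1 J2 \<tau> \<theta>. L \<le> CARD('n) \<Longrightarrow> k < L \<Longrightarrow> (J1, J2) \<in> pairs_H \<psi> \<J> L k \<Longrightarrow>
        \<tau> > 0 \<Longrightarrow> \<theta> > 0 \<Longrightarrow> \<theta> \<ge> \<delta>' J1 J2 * \<tau> \<Longrightarrow>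
        measure lebesgue (cylT nrm \<psi> J1 \<tau> \<inter> cylT nrm \<psi> J2 \<tau> \<inter> sublevel fd \<theta>)
          \<le> const_Q \<delta>2 fd \<psi> J1 J2 * \<tau> ^ (CARD('n) - k) * (\<theta> + \<delta>' J1 J2 * \<tau>) ^ k"
    and K: "K \<le> CARD('n)"
  shows "(\<forall>\<tau> \<theta>. \<tau> > 0 \<longrightarrow> \<theta> \<ge> \<tau> * Delta \<psi> \<J> \<delta> \<delta>' K \<longrightarrow>
      bar_C nrm fd \<psi> \<J> K * \<tau> ^ (CARD('n) - K) * (\<theta> - hat_delta \<J> \<delta> K * \<tau>) ^ K
          - \<theta> ^ CARD('n) * eps0 \<delta>2 fd \<psi> \<J> \<delta>' K \<tau> \<theta>
        \<le> measure lebesgue (sparse_data nrm \<psi> I K \<tau> \<inter> sublevel fd \<theta>) \<and>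
      measure lebesgue (sparse_data nrm \<psi> I K \<tau> \<inter> sublevel fd \<theta>)
        \<le> bar_C nrm fd \<psi> \<J> K * \<tau> ^ (CARD('n) - K) * (\<theta> + hat_delta \<J> \<delta> K * \<tau>) ^ K)
    \<and> 0 \<le> hat_delta \<J> \<delta> K \<and> hat_delta \<J> \<delta> K \<le> \<delta>1 * \<delta>2
    \<and> 0 \<le> Delta \<psi> \<J> \<delta> \<delta>' K \<and> Delta \<psi> \<J> \<delta> \<delta>' K \<le> 3 * (\<delta>1 * \<delta>2)
    \<and> (0 < K \<and> K < CARD('n) \<longrightarrow>
        (\<forall>k. k_min CARD('n) K \<le> k \<and> k \<le> K - 1 \<longrightarrow>
          0 \<le> hat_delta' \<psi> \<J> \<delta>' K k \<and> hat_delta' \<psi> \<J> \<delta>' K k \<le> 3 * (\<delta>1 * \<delta>2)))"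
proof -
  interpret sparsity_setting nrm fd \<psi> I "\<delta>1 * \<delta>2" \<delta>2 \<delta> \<delta>' \<J>
    using delta'(2) by unfold_locales (simp_all add: norms dictionary delta representatives delta'(1))
  have N: "DIM(real ^ 'n) = CARD('n)"
    by simp
  \<comment> \<open>The bounds on \<open>hat_delta'\<close> ask for \<open>k < K\<close>, which
    follows from \<open>k \<le> K - 1\<close> because \<open>K\<close> is positive there.\<close>
  note bounds = sparse_data_measure_bounds[unfolded N, OF K]
    hat_delta_bounds[unfolded N, OF K] Delta_bounds[unfolded N, OF K] hat_delta'_bounds[unfolded N, OF K]
  show ?thesis
    using bounds by auto
qed

end
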